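(* Let $\Gamma$ be a concave, strictly decreasing curve in the first quadrant with $x$-intercept $L>0$ and $y$-intercept $M>0$ (not necessarily equal), given by $y=f(x)$ with inverse function $x=g(y)$. Take a point $(\alpha,\beta)\in\Gamma$ with $\alpha,\beta>0$, and assume that $f\in C^2[0,\alpha]$ with $f'<0$ on $(0,\alpha]$ and $f''<0$ on $[0,\alpha]$, and similarly $g\in C^2[0,\beta]$ with $g'<0$ on $(0,\beta]$ and $g''<0$ on $[0,\beta]$. Further suppose $f''$ is monotonic on $[0,\alpha]$ and $g''$ is monotonic on $[0,\beta]$. (a) The number $N$ of positive-integer lattice points inside $\Gamma$ in the first quadrant satisfies $$\big|N-\operatorname{Area}(\Gamma)+(L+M)/2\big|\le 6\Big(\int_0^\alpha|f''(x)|^{1/3}\,dx+\int_0^\beta|g''(y)|^{1/3}\,dy\Big)+175\Big(\max_{[0,\alpha]}\frac1{|f''|^{1/2}}+\max_{[0,\beta]}\frac1{|g''|^{1/2}}\Big)+\frac14\big(|f'(\alpha)|+|g'(\beta)|\big)+3 .$$ (b) The number $N(r,s)$ of positive-integer lattice points lying inside $r\Gamma(s)$ in the first quadrant satisfies, for all $r,s>0$, $$\big|N(r,s)-r^2\operatorname{Area}(\Gamma)+r(s^{-1}L+sM)/2\big|\le 6r^{2/3}\Big(\int_0^\alpha|f''(x)|^{1/3}\,dx+\int_0^\beta|g''(y)|^{1/3}\,dy\Big)+175r^{1/2}\Big(\max_{[0,\alpha]}\frac{s^{-3/2}}{|f''|^{1/2}}+\max_{[0,\beta]}\frac{s^{3/2}}{|g''|^{1/2}}\Big)+\frac14\big(s^2|f'(\alpha)|+s^{-2}|g'(\beta)|\big)+3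 .$$
   Context: $\mathbb{N}=\{1,2,3,\dots\}$. The curve $\Gamma$ is the graph $y=f(x)$, $x\in[0,L]$, of a continuous, concave, strictly decreasing function $f:[0,L]\to[0,M]$ with $f(0)=M$ and $f(L)=0$; $g:[0,M]\to[0,L]$ is the inverse function of $f$. $\operatorname{Area}(\Gamma)$ is the area enclosed by $\Gamma$ and the coordinate axes. For $r,s>0$, the curve $r\Gamma(s)$ is the image of $\Gamma$ under $(x,y)\mapsto(rs^{-1}x,\,rsy)$, i.e. the graph of $x\mapsto rsf(sx/r)$ on $[0,rs^{-1}L]$. Lattice points are counted inside or on the curve: $$N(r,s)=\#\{(j,k)\in\mathbb{N}\times\mathbb{N}: js/r\le L,\ k\le rsf(js/r)\},\qquad N=N(1,1).$$ *)

theory Defs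
  imports "HOL-Analysis.Analysis"
begin

text \<open>
  A curve in the first quadrant is the graph of \<open>f\<close> over \<open>{0..L}\<close>. Here \<open>f\<close> is a total function
  on \<open>real\<close>; its values outside \<open>{0..L}\<close> are never used.
\<close>

definition curve :: "real \<Rightarrow> (real \<Rightarrow> real) \<Rightarrow> (real \<times> real) set"
  where "curve L f = {(x, f x) |x. x \<in> {0..L}}"

definition curve_area :: "real \<Rightarrow> (real \<Rightarrow> real) \<Rightarrow> real"
  where "curve_area L f = measure lborel {(x, y). 0 \<le> x \<and> x \<le> L \<and> 0 \<le> y \<and> y \<le> f x}"

text \<open>
  The dilated and stretched curve, the image of the graph of \<open>f\<close> under
  \<open>(x, y) \<mapsto> (r x / s, r s y)\<close>, is the graph of \<open>x \<mapsto> r s f (s x / r)\<close> over \<open>{0..r L / s}\<close>. Lattice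
  points on it are counted, those on the coordinate axes are not.
\<close>

definition lattice_count :: "real \<Rightarrow> (real \<Rightarrow> real) \<Rightarrow> real \<Rightarrow> real \<Rightarrow> nat"
  where "lattice_count L f r s =
    card {(j :: nat, k :: nat). 0 < j \<and> 0 < k \<and>
      real j * s / r \<le> L \<and> real k \<le> r * s * f (real j * s / r)}"

text \<open>
  On an interval \<open>S = {a..b}\<close> with \<open>a < b\<close> the derivatives are uniquely determined on \<open>S\<close>, and are
  one-sided at the endpoints.
\<close>

definition C2_on :: "real set \<Rightarrow> (real \<Rightarrow> real) \<Rightarrow> (real \<Rightarrow> real) \<Rightarrow> (real \<Rightarrow> real) \<Rightarrow> bool"
  where "C2_on S f f' f'' \<longleftrightarrow>
    (\<forall>x\<in>S. (f has_real_derivative f' x) (at x within S)) \<and>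
    (\<forall>x\<in>S. (f' has_real_derivative f'' x) (at x within S)) \<and>
    continuous_on S f''"

end

theory Submission
  imports Defs
begin

text \<open>
  Write \<open>\<psi>(t) = t - \<lfloor>t\<rfloor> - 1/2\<close> for the sawtooth. Cutting the region under the curve at \<open>(\<alpha>, \<beta>)\<close>
  expresses its lattice points as the points above \<open>(0, \<alpha>]\<close>, plus the points to the right of
  \<open>(0, \<beta>]\<close>, minus those of the rectangle \<open>[0, \<alpha>] \<times> [0, \<beta>]\<close>; its area decomposes in the same way.
  The first count is \<open>\<Sum> \<lfloor>f(n)\<rfloor> = \<Sum> f(n) - \<lfloor>\<alpha>\<rfloor>/2 - \<Sum> \<psi>(f(n))\<close> over \<open>0 < n \<le> \<alpha>\<close>. By Euler-Maclaurin
  (\<open>sum_eq_integral\<close>) the sum of \<open>f(n)\<close> is the integral of \<open>f\<close> plus boundary terms, up to \<open>\<bar>f'(\<alpha>)\<bar>/8\<close>.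
  The second count is treated alike, and the boundary terms of the two sides, the rectangle and
  \<open>\<lfloor>\<alpha>\<rfloor> \<lfloor>\<beta>\<rfloor>\<close> combine to \<open>- (L + M)/2\<close> up to an error of at most \<open>1/2\<close>.

  What remains is van der Corput's estimate for \<open>\<Sum> \<psi>(f(n))\<close> (\<open>van_der_corput_sawtooth\<close>). On a block
  where \<open>\<Lambda> \<le> \<bar>f''\<bar> \<le> 2 \<Lambda>\<close>, the sawtooth is compared with difference quotients, at a scale \<open>\<eta>\<close>, of its
  periodic primitive, whose Fourier series \<open>\<Sum> cos (2 \<pi> h t) / h\<^sup>2\<close> converges absolutely. This bounds
  the sum by \<open>\<eta>\<close> times half the number of terms plus a weighted series of the exponential sums
  \<open>\<Sum> e(h f(n))\<close>. The second derivative test (\<open>van_der_corput_second_difference\<close>, deduced from the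
  Kusmin-Landau inequality \<open>kusmin_landau\<close>) bounds such a sum of \<open>K\<close> terms by
  \<open>10 K (h \<Lambda>)\<^sup>1\<^sup>/\<^sup>2 + 11 (h \<Lambda>)\<^sup>-\<^sup>1\<^sup>/\<^sup>2\<close>. With \<open>\<eta>\<close> proportional to \<open>\<Lambda>\<^sup>1\<^sup>/\<^sup>3\<close> the two contributions balance and
  give \<open>6 \<Lambda>\<^sup>1\<^sup>/\<^sup>3\<close> times the length of the block, which is at most \<open>6 \<integral> \<bar>f''\<bar>\<^sup>1\<^sup>/\<^sup>3\<close>, plus \<open>21 \<Lambda>\<^sup>-\<^sup>1\<^sup>/\<^sup>2\<close>. A monotone
  \<open>f''\<close> cuts \<open>[0, \<alpha>]\<close> into finitely many such blocks, one for each power of two, and possibly a piece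
  with \<open>\<bar>f''\<bar> > 1/1728\<close>, where \<open>\<bar>\<psi>\<bar> \<le> 1/2\<close> suffices. The terms \<open>21 \<Lambda>\<^sup>-\<^sup>1\<^sup>/\<^sup>2\<close> form a geometric series dominated
  by its largest member; this costs far less than \<open>175\<close>.

  The stretched curve satisfies the same hypotheses as the original one, so the second estimate is
  the first one applied to it, each term being rescaled. Conversely the first is the case \<open>r = s = 1\<close>.
\<close>

section \<open>Exponential sums\<close>

lemma inverse_one_minus_cis:
  assumes "sin x \<noteq> 0"
  shows "1 / (1 - cis (2 * x)) = Complex (1/2) (cot x / 2)"
proof -
  have c2: "cos (2 * x) = 1 - 2 * (sin x)\<^sup>2" and s2: "sin (2 * x) = 2 * sin x * cos x"
    by (simp_all add: cos_double_sin sin_double)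
  have "(sin x)\<^sup>2 + (cos x)\<^sup>2 = 1" by simp
  then have "(1 - cis (2 * x)) * Complex (1/2) (cot x / 2) = 1"
    using assms unfolding complex_eq_iff
    by (simp add: c2 s2 cot_def) (simp add: field_simps power2_eq_square)
  then show ?thesis
    by (metis mult_zero_left nonzero_eq_divide_eq mult.commute zero_neq_one)
qed

text \<open>
  Jordan's inequality \<open>2 x \<le> sin (\<pi> x)\<close> on \<open>[0, 1/2]\<close> is concavity of the sine; the symmetry about
  \<open>1/2\<close> carries it to the other half.
\<close>

lemma two_mult_le_sin_pi:
  assumes "0 \<le> d" "d \<le> t" "t \<le> 1 - d"
  shows "2 * d \<le> sin (pi * t)"
proof -
  have lin: "2 * x \<le> sin (pi * x)" if "0 \<le> x" "x \<le> 1/2" for x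
  proof -
    have "concave_on {0..pi} sin"
      by (rule f''_le0_imp_concave[where f' = cos and f'' = "\<lambda>x. - sin x"])
        (auto intro!: derivative_eq_intros sin_ge_zero)
    from concave_onD[OF this, of "2 * x" 0 "pi/2"] that
    show ?thesis by (simp add: algebra_simps)
  qed
  show ?thesis
  proof (cases "t \<le> 1/2")
    case True
    then show ?thesis using lin[of t] assms by linarith
  next
    case False
    have "pi * (1 - t) = pi - pi * t" by (simp add: algebra_simps)
    then have "sin (pi * (1 - t)) = sin (pi * t)" by (metis sin_pi_minus)
    moreover have "2 * (1 - t) \<le> sin (pi * (1 - t))"
      using assms False by (intro lin) auto
    ultimately have "2 * (1 - t) \<le> sin (pi * t)" by metis
    moreover have "2 * d \<le> 2 * (1 - t)" using assms by simp
    ultimately show ?thesis by (rule order_trans[rotated])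
  qed
qed

lemma cot_pi_antimono:
  assumes "0 < x" "x \<le> y" "y < 1"
  shows "cot (pi * y) \<le> cot (pi * x)"
proof -
  have sx: "0 < sin (pi * x)" "0 < sin (pi * y)"
    using assms by (auto intro!: sin_gt_zero)
  have "0 \<le> sin (pi * y - pi * x)"
  proof (rule sin_ge_zero)
    have "pi * y \<le> pi * 1" using assms by (intro mult_left_mono) auto
    moreover have "0 \<le> pi * x" using assms by simp
    ultimately show "pi * y - pi * x \<le> pi" by linarith
  qed (use assms in simp)
  then show ?thesis
    using sx by (simp add: cot_def sin_diff field_simps)
qed

text \<open>
  With \<open>\<theta>\<^sub>n\<close> for the difference of \<open>u\<close> at \<open>n\<close> minus \<open>m\<close>, and \<open>c\<^sub>n = 1 / (1 - e(\<theta>\<^sub>n)) = 1/2 + (i/2) cot (\<pi> \<theta>\<^sub>n)\<close>,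
  one has \<open>e(u\<^sub>n) = c\<^sub>n (e(u\<^sub>n) - e(u\<^sub>n\<^sub>+\<^sub>1))\<close>. Summation by parts leaves the differences of the \<open>c\<^sub>n\<close>. All
  of them are multiples of \<open>i\<close> of the same sign, because the \<open>\<theta>\<^sub>n\<close> are monotone, so that the sum of their
  absolute values telescopes.
\<close>

lemma kusmin_landau:
  fixes u :: "nat \<Rightarrow> real" and m :: int and d :: real
  assumes d: "0 < d"
    and dec: "\<And>n. Suc n < K \<Longrightarrow> u (Suc (Suc n)) - u (Suc n) \<le> u (Suc n) - u n"
    and rng: "\<And>n. n < K \<Longrightarrow> m + d \<le> u (Suc n) - u n \<and> u (Suc n) - u n \<le> m + 1 - d"
  shows "norm (\<Sum>n<K. cis (2 * pi * u n)) \<le> 1 / d"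
proof (cases "K = 0")
  case False
  define t where "t n = u (Suc n) - u n - m" for n
  define E where "E n = cis (2 * pi * u n)" for n
  define c where "c n = Complex (1/2) (cot (pi * t n) / 2)" for n
  have t: "d \<le> t n" "t n \<le> 1 - d" "0 < t n" "t n < 1" if "n < K" for n
    using rng[OF that] d by (auto simp: t_def)
  have sin_t: "2 * d \<le> sin (pi * t n)" if "n < K" for n
    using two_mult_le_sin_pi[of d "t n"] d t[OF that] by linarith
  have E_eq: "E n = c n * (E n - E (Suc n))" if "n < K" for n
  proof -
    have "2 * pi * u (Suc n) = 2 * pi * u n + (2 * pi * t n + 2 * pi * m)"
      by (simp add: t_def algebra_simps)
    then have "E (Suc n) = E n * cis (2 * pi * t n)"
      by (simp add: E_def flip: cis_mult)
    then have "E n - E (Suc n) = E n * (1 - cis (2 * pi * t n))"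
      by (simp add: algebra_simps)
    moreover have "c n * (1 - cis (2 * pi * t n)) = 1"
    proof -
      have s: "sin (pi * t n) \<noteq> 0" using sin_t[OF that] d by auto
      have c: "c n = 1 / (1 - cis (2 * pi * t n))"
        using inverse_one_minus_cis[OF s] by (simp add: c_def mult.assoc)
      have "c n \<noteq> 0" by (simp add: c_def complex_eq_iff)
      then show ?thesis unfolding c by auto
    qed
    ultimately show ?thesis by (metis mult.left_commute mult.right_neutral)
  qed
  have norm_E [simp]: "norm (E n) = 1" for n by (simp add: E_def)
  have cot_le: "\<bar>cot (pi * t n)\<bar> \<le> 1 / (2 * d)" if "n < K" for n
  proof -
    have "\<bar>cot (pi * t n)\<bar> = \<bar>cos (pi * t n)\<bar> / sin (pi * t n)"
      using sin_t[OF that] d by (simp add: cot_def abs_divide)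
    also have "\<dots> \<le> 1 / (2 * d)"
      using sin_t[OF that] d by (intro frac_le) auto
    finally show ?thesis .
  qed
  have norm_c: "norm (c n) \<le> 1 / (4 * d)" if "n < K" for n
  proof -
    have s: "sin (pi * t n) > 0" using sin_t[OF that] d by auto
    have "1 + (cot (pi * t n))\<^sup>2 = 1 / (sin (pi * t n))\<^sup>2"
      using s by (simp add: cot_def field_simps flip: power_mult_distrib)
    then have "(norm (c n))\<^sup>2 = (1 / (2 * sin (pi * t n)))\<^sup>2"
      unfolding c_def cmod_power2 by (simp add: power_divide power_mult_distrib)
    then have "norm (c n) = 1 / (2 * sin (pi * t n))"
      using s by (simp add: power2_eq_iff_nonneg)
    also have "\<dots> \<le> 1 / (2 * (2 * d))"
      using sin_t[OF that] d s by (intro frac_le mult_left_mono) auto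
    finally show ?thesis by simp
  qed
  \<comment> \<open>summation by parts, carried out as an induction on the length of the sum\<close>
  have partial: "norm ((\<Sum>n<Suc k. E n) + c k * E (Suc k))
      \<le> norm (c 0) + (cot (pi * t k) - cot (pi * t 0)) / 2" if "k < K" for k
    using that
  proof (induction k)
    case 0
    have "E 0 + c 0 * E (Suc 0) = c 0 * E 0"
      using E_eq[OF 0] by (simp add: algebra_simps)
    then show ?case by (simp add: norm_mult)
  next
    case (Suc k)
    have "t (Suc k) \<le> t k" using dec[of k] Suc.prems by (simp add: t_def)
    then have cot: "cot (pi * t k) \<le> cot (pi * t (Suc k))"
      using t[of k] t[of "Suc k"] Suc.prems by (intro cot_pi_antimono) auto
    have "(\<Sum>n<Suc (Suc k). E n) + c (Suc k) * E (Suc (Suc k))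
        = ((\<Sum>n<Suc k. E n) + c k * E (Suc k)) + (c (Suc k) - c k) * E (Suc k)"
      using E_eq[OF Suc.prems] by (simp add: algebra_simps)
    also have "norm \<dots> \<le> norm ((\<Sum>n<Suc k. E n) + c k * E (Suc k)) + norm (c (Suc k) - c k)"
      by (rule norm_triangle_le) (simp add: norm_mult)
    also have "c (Suc k) - c k = Complex 0 ((cot (pi * t (Suc k)) - cot (pi * t k)) / 2)"
      by (simp add: c_def complex_eq_iff diff_divide_distrib)
    also have "norm \<dots> = (cot (pi * t (Suc k)) - cot (pi * t k)) / 2"
      using cot by (simp add: complex_norm)
    finally show ?case using Suc by (simp add: field_simps)
  qed
  define k where "k = K - 1"
  have k: "k < K" "K = Suc k" and k0: "0 < K" using False by (auto simp: k_def)
  have "norm (\<Sum>n<K. E n) \<le> norm ((\<Sum>n<Suc k. E n) + c k * E (Suc k)) + norm (c k)"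
    unfolding k(2) by (metis add_diff_cancel_right' norm_E norm_mult norm_triangle_ineq4 mult.right_neutral)
  also have "\<dots> \<le> 1 / (4 * d) + (1 / (2 * d) + 1 / (2 * d)) / 2 + 1 / (4 * d)"
    using partial[OF k(1)] norm_c[OF k(1)] norm_c[OF k0] cot_le[OF k(1)] cot_le[OF k0]
    unfolding abs_le_iff diff_divide_distrib add_divide_distrib by linarith
  also have "\<dots> = 1 / d" using d by (simp add: field_simps)
  finally show ?thesis by (simp add: E_def)
qed (use d in auto)

text \<open>
  The indices whose difference lies in a prescribed interval form such a set when the differences are
  monotone.
\<close>

lemma order_convex_nat_set_eq_interval:
  fixes S :: "nat set"
  assumes "finite S" "\<And>i j k. i \<in> S \<Longrightarrow> k \<in> S \<Longrightarrow> i \<le> j \<Longrightarrow> j \<le> k \<Longrightarrow> j \<in> S"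
  obtains p q where "S = {p..<q}"
proof (cases "S = {}")
  case True
  then show ?thesis using that[of 0 0] by simp
next
  case False
  have "S = {Min S..<Suc (Max S)}"
    using assms(2)[OF Min_in[OF assms(1) False] Max_in[OF assms(1) False]] assms(1)
    by (auto simp: less_Suc_eq_le)
  then show ?thesis by (rule that)
qed

lemma kusmin_landau_on:
  fixes u :: "nat \<Rightarrow> real" and m :: int and d :: real
  assumes d: "0 < d" and fin: "finite S"
    and cvx: "\<And>i j k. i \<in> S \<Longrightarrow> k \<in> S \<Longrightarrow> i \<le> j \<Longrightarrow> j \<le> k \<Longrightarrow> j \<in> S"
    and dec: "\<And>n. n \<in> S \<Longrightarrow> Suc n \<in> S \<Longrightarrow> u (Suc (Suc n)) - u (Suc n) \<le> u (Suc n) - u n"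
    and rng: "\<And>n. n \<in> S \<Longrightarrow> m + d \<le> u (Suc n) - u n \<and> u (Suc n) - u n \<le> m + 1 - d"
  shows "norm (\<Sum>n\<in>S. cis (2 * pi * u n)) \<le> 1 / d"
proof -
  obtain p q where pq: "S = {p..<q}"
    using order_convex_nat_set_eq_interval[OF fin] cvx by metis
  have "norm (\<Sum>n<q - p. cis (2 * pi * u (p + n))) \<le> 1 / d"
    using kusmin_landau[OF d, of "q - p" "\<lambda>n. u (p + n)" m] dec rng by (simp add: pq)
  also have "(\<Sum>n<q - p. cis (2 * pi * u (p + n))) = (\<Sum>n\<in>S. cis (2 * pi * u n))"
    unfolding pq by (intro sum.reindex_bij_witness[of _ "\<lambda>n. n - p" "\<lambda>n. p + n"]) auto
  finally show ?thesis .
qed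

text \<open>
  Consecutive values are at least \<open>\<mu>\<close> apart, so an interval of length \<open>w\<close> holds about \<open>w / \<mu>\<close> of them.
\<close>

lemma card_slow_differences:
  fixes t :: "nat \<Rightarrow> real"
  assumes mu: "0 < \<mu>"
    and step: "\<And>i j. i \<le> j \<Longrightarrow> j < K \<Longrightarrow> \<mu> * (j - i) \<le> t i - t j"
  shows "card {n. n < K \<and> x < t n \<and> t n < x + w} \<le> max 0 w / \<mu> + 1"
proof -
  define S where "S = {n. n < K \<and> x < t n \<and> t n < x + w}"
  have antimono: "t j \<le> t i" if "i \<le> j" "j < K" for i j
  proof -
    have "0 \<le> \<mu> * (real j - real i)" using that mu by simp
    then show ?thesis using step[OF that] by linarith
  qed
  have "j \<in> S" if "i \<in> S" "k \<in> S" "i \<le> j" "j \<le> k" for i j k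
    using that antimono[of i j] antimono[of j k] by (auto simp: S_def)
  moreover have "finite S" by (simp add: S_def)
  ultimately obtain p q where pq: "S = {p..<q}"
    using order_convex_nat_set_eq_interval by metis
  have "real (card S) \<le> max 0 w / \<mu> + 1"
  proof (cases "p < q")
    case True
    then have "p \<in> S" "q - 1 \<in> S" unfolding pq by auto
    then have "t p - t (q - 1) < w" "\<mu> * (real (q - 1) - real p) \<le> t p - t (q - 1)"
      using step[of p "q - 1"] True by (auto simp: S_def)
    then have "\<mu> * (real q - 1 - real p) \<le> w" using True by (simp add: of_nat_diff)
    then have "\<mu> * (real q - 1 - real p) \<le> max 0 w" by simp
    then have "real q - 1 - real p \<le> max 0 w / \<mu>" using mu by (simp add: field_simps)
    then show ?thesis unfolding pq using True by (simp add: of_nat_diff)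
  next
    case False
    then show ?thesis unfolding pq using mu by simp
  qed
  then show ?thesis by (simp add: S_def)
qed

text \<open>
  The terms are grouped by the integer \<open>m\<close> nearest to the difference \<open>\<theta>\<^sub>n\<close> of \<open>u\<close> at \<open>n\<close>. Within a
  group, the terms with \<open>\<bar>\<theta>\<^sub>n - m\<bar> < d\<close> number at most \<open>2 d / \<mu> + 1\<close> and are estimated trivially, while
  on the two sides of them the Kusmin-Landau inequality gives \<open>1 / d\<close> each. As the \<open>\<theta>\<^sub>n\<close> decrease by at most
  \<open>2 \<mu>\<close> per step, there are at most \<open>2 \<mu> K + 2\<close> groups. The choice \<open>d = sqrt \<mu>\<close> balances the bounds;
  it makes sense for \<open>\<mu> \<le> 1\<close>, and for larger \<open>\<mu>\<close> the trivial bound \<open>K\<close> is good enough.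
\<close>

lemma van_der_corput_second_difference:
  fixes u :: "nat \<Rightarrow> real"
  assumes mu: "0 < \<mu>"
    and lower: "\<And>n. n + 2 < K \<Longrightarrow> \<mu> \<le> 2 * u (n + 1) - u n - u (n + 2)"
    and upper: "\<And>n. n + 2 < K \<Longrightarrow> 2 * u (n + 1) - u n - u (n + 2) \<le> 2 * \<mu>"
  shows "norm (\<Sum>n<K. cis (2 * pi * u n)) \<le> 10 * real K * sqrt \<mu> + 11 / sqrt \<mu>"
proof -
  define E where "E n = cis (2 * pi * u n)" for n
  have norm_E [simp]: "norm (E n) = 1" for n by (simp add: E_def)
  have trivial: "norm (\<Sum>n<k. E n) \<le> k" for k
    using norm_sum[of E "{..<k}"] by simp
  consider "\<mu> > 1" | "K \<le> 1" "\<mu> \<le> 1" | "K > 1" "\<mu> \<le> 1" by linarith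
  then have "norm (\<Sum>n<K. E n) \<le> 10 * real K * sqrt \<mu> + 11 / sqrt \<mu>"
  proof cases
    case 1
    have "1 * (real K * 1) \<le> 10 * (K * sqrt \<mu>)" using 1 by (intro mult_mono) auto
    moreover have "0 \<le> 11 / sqrt \<mu>" using mu by simp
    ultimately show ?thesis using trivial[of K] by linarith
  next
    case 2
    have "sqrt \<mu> \<le> 1" using 2 by simp
    then have "sqrt \<mu> \<le> 11" by linarith
    then have "1 \<le> 11 / sqrt \<mu>" using mu by (subst pos_le_divide_eq) auto
    moreover have "0 \<le> 10 * real K * sqrt \<mu>" using mu by simp
    ultimately show ?thesis using trivial[of K] 2 by linarith
  next
    case 3
    \<comment> \<open>the last term has no difference inside the range; it is set aside and costs at most \<open>1\<close>\<close>
    define k where "k = K - 1"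
    have k: "K = Suc k" "0 < k" using 3 by (auto simp: k_def)
    define t where "t n = u (Suc n) - u n" for n
    define d where "d = sqrt \<mu>"
    have d: "0 < d" "d \<le> 1" "d * d = \<mu>" using mu 3 by (auto simp: d_def)
    have step: "\<mu> * (real j - real i) \<le> t i - t j \<and> t i - t j \<le> 2 * \<mu> * (real j - real i)"
      if "i \<le> j" "j < k" for i j
      using that
    proof (induction j)
      case (Suc j)
      show ?case
      proof (cases "i \<le> j")
        case True
        then have IH: "\<mu> * (real j - real i) \<le> t i - t j" "t i - t j \<le> 2 * \<mu> * (real j - real i)"
          using Suc by auto
        have "\<mu> \<le> t j - t (Suc j)" "t j - t (Suc j) \<le> 2 * \<mu>"
          using lower[of j] upper[of j] Suc.prems k by (auto simp: t_def)
        then show ?thesis using IH by (simp add: algebra_simps)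
      next
        case False
        then have "i = Suc j" using Suc.prems by simp
        then show ?thesis by simp
      qed
    qed auto
    have dec: "u (Suc j) - u j \<le> u (Suc i) - u i" if "i \<le> j" "j < k" for i j
    proof -
      have "0 \<le> \<mu> * (real j - real i)" using that mu by simp
      then show ?thesis using step[OF that] by (simp add: t_def)
    qed
    define rd where "rd n = \<lfloor>t n + 1/2\<rfloor>" for n
    have class_bound: "norm (\<Sum>n\<in>{n. n < k \<and> rd n = m}. E n) \<le> 5 / d" for m
    proof -
      define A where "A = {n. n < k \<and> rd n = m \<and> m + d \<le> t n}"
      define B where "B = {n. n < k \<and> rd n = m \<and> t n \<le> m - d}"
      define C where "C = {n. n < k \<and> rd n = m \<and> m - d < t n \<and> t n < m + d}"
      have rdm: "rd n = m \<longleftrightarrow> m - 1/2 \<le> t n \<and> t n < m + 1/2" for n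
        unfolding rd_def floor_eq_iff by auto
      have split: "{n. n < k \<and> rd n = m} = A \<union> (B \<union> C)"
        by (auto simp: A_def B_def C_def)
      have disj: "A \<inter> (B \<union> C) = {}" "B \<inter> C = {}" using d by (auto simp: A_def B_def C_def)
      have fin: "finite A" "finite B" "finite C" by (auto simp: A_def B_def C_def)
      have cvx: "j \<in> X" if "X \<in> {A, B}" "i \<in> X" "l \<in> X" "i \<le> j" "j \<le> l" for X i j l
      proof -
        have "l < k" "j < k" using that by (auto simp: A_def B_def)
        then show ?thesis
          using that dec[of i j] dec[of j l] by (auto simp: A_def B_def rdm t_def)
      qed
      \<comment> \<open>above \<open>m\<close> the differences lie in \<open>[m + d, m + 1/2)\<close>; if \<open>d\<close> exceeds \<open>1/2\<close> this set is empty\<close>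
      have A: "norm (sum E A) \<le> 1 / d"
        unfolding E_def
      proof (rule kusmin_landau_on[OF d(1) fin(1), where m = m])
        fix n assume "n \<in> A"
        then show "m + d \<le> u (Suc n) - u n \<and> u (Suc n) - u n \<le> m + 1 - d"
          using d unfolding A_def rdm t_def by simp
      next
        fix n assume "n \<in> A" "Suc n \<in> A"
        then show "u (Suc (Suc n)) - u (Suc n) \<le> u (Suc n) - u n"
          using dec[of n "Suc n"] by (simp add: A_def)
      qed (rule cvx[of A], simp_all)
      have B: "norm (sum E B) \<le> 1 / d"
        unfolding E_def
      proof (rule kusmin_landau_on[OF d(1) fin(2), where m = "m - 1"])
        fix n assume "n \<in> B"
        then show "(m - 1) + d \<le> u (Suc n) - u n \<and> u (Suc n) - u n \<le> (m - 1) + 1 - d"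
          unfolding B_def rdm t_def by simp
      next
        fix n assume "n \<in> B" "Suc n \<in> B"
        then show "u (Suc (Suc n)) - u (Suc n) \<le> u (Suc n) - u n"
          using dec[of n "Suc n"] by (simp add: B_def)
      qed (rule cvx[of B], simp_all)
      have "card C \<le> card {n. n < k \<and> m - d < t n \<and> t n < (m - d) + 2 * d}"
        by (intro card_mono) (auto simp: C_def)
      moreover have "real (card {n. n < k \<and> m - d < t n \<and> t n < (m - d) + 2 * d}) \<le> max 0 (2 * d) / \<mu> + 1"
        by (rule card_slow_differences[OF mu]) (use step in auto)
      ultimately have "real (card C) \<le> 2 * d / \<mu> + 1" using d by linarith
      moreover have "norm (sum E C) \<le> card C" using norm_sum[of E C] by simp
      moreover have "2 * d / \<mu> = 2 / d" using d(1) by (simp flip: d(3))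
      moreover have "1 \<le> 1 / d" using d by simp
      moreover have "norm (sum E (A \<union> (B \<union> C))) \<le> norm (sum E A) + (norm (sum E B) + norm (sum E C))"
        using disj fin by (simp add: sum.union_disjoint norm_triangle_le)
      ultimately show ?thesis using A B unfolding split by simp
    qed
    have "rd ` {..<k} \<subseteq> {rd (k - 1)..rd 0}"
      using dec[of 0] dec[of _ "k - 1"] k by (force simp: rd_def t_def intro!: floor_mono)
    then have "card (rd ` {..<k}) \<le> card {rd (k - 1)..rd 0}" by (intro card_mono) auto
    moreover have "rd (k - 1) \<le> rd 0" using dec[of 0 "k - 1"] k by (auto simp: rd_def t_def intro!: floor_mono)
    ultimately have "real (card (rd ` {..<k})) \<le> rd 0 - rd (k - 1) + 1" by simp
    also have "\<dots> \<le> t 0 - t (k - 1) + 2" unfolding rd_def by linarith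
    also have "\<dots> \<le> 2 * \<mu> * K + 2"
    proof -
      have "t 0 - t (k - 1) \<le> 2 * \<mu> * (real (k - 1) - real 0)" using step[of 0 "k - 1"] k by simp
      also have "\<dots> \<le> 2 * \<mu> * K" using k mu by (intro mult_left_mono) auto
      finally show ?thesis by simp
    qed
    finally have classes: "real (card (rd ` {..<k})) \<le> 2 * \<mu> * K + 2" .
    have "(\<Sum>n<k. E n) = (\<Sum>m\<in>rd ` {..<k}. \<Sum>n\<in>{n. n < k \<and> rd n = m}. E n)"
      using sum.image_gen[of "{..<k}" E rd] by simp
    also have "norm \<dots> \<le> of_nat (card (rd ` {..<k})) * (5 / d)"
      by (rule sum_norm_bound) (use class_bound in auto)
    also have "\<dots> \<le> (2 * \<mu> * K + 2) * (5 / d)"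
      using classes d by (intro mult_right_mono) auto
    also have "\<dots> = 10 * real K * d + 10 / d" using d by (simp add: field_simps flip: d(3))
    finally have "norm (\<Sum>n<k. E n) \<le> 10 * real K * d + 10 / d" .
    moreover have "norm (\<Sum>n<K. E n) \<le> norm (\<Sum>n<k. E n) + 1"
      unfolding k(1) by (simp add: norm_triangle_le)
    moreover have "1 \<le> 1 / d" using d by simp
    ultimately show ?thesis by (simp add: d_def)
  qed
  then show ?thesis by (simp add: E_def)
qed

section \<open>The sawtooth function and the Fourier series of its primitive\<close>

lemma dirichlet_kernel:
  fixes x :: real
  shows "2 * sin (x/2) * (1/2 + (\<Sum>n<H. cos (real (Suc n) * x))) = sin ((H + 1/2) * x)"
proof (induction H)
  case (Suc H)
  have "sin ((Suc H + 1/2) * x) - sin ((H + 1/2) * x) = 2 * sin (x/2) * cos (real (Suc H) * x)"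
  proof -
    have e: "(Suc H + 1/2) * x = real (Suc H) * x + x/2" "(H + 1/2) * x = real (Suc H) * x - x/2"
      by (simp_all add: field_simps)
    show ?thesis unfolding e sin_add sin_diff by simp
  qed
  then show ?case using Suc by (simp add: algebra_simps)
qed simp

text \<open>
  The derivative of the error is minus the Dirichlet kernel, \<open>- sin (c x) / (2 sin (x/2))\<close> with
  \<open>c = H + 1/2\<close>. Integrating this by parts from \<open>\<pi>\<close>, where the error vanishes, gains a factor
  \<open>1 / c\<close>, uniformly away from the multiples of \<open>2 \<pi>\<close>.
\<close>

lemma sine_series_error:
  fixes x :: real
  assumes a: "0 < a" "a \<le> x" "x \<le> 2 * pi - a"
  shows "\<bar>(pi - x) / 2 - (\<Sum>n<H. sin (real (Suc n) * x) / real (Suc n))\<bar>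
    \<le> (pi / (4 * (sin (a/2))\<^sup>2) + 1 / (2 * sin (a/2)) + 1/2) / (H + 1/2)"
proof -
  define c where "c = real H + 1/2"
  define s where "s = sin (a/2)"
  define T where "T x = (pi - x) / 2 - (\<Sum>n<H. sin (real (Suc n) * x) / real (Suc n))" for x :: real
  \<comment> \<open>\<open>V\<close> is \<open>T\<close> without the boundary term of the integration by parts, so \<open>V\<close> has a derivative of order \<open>1 / c\<close>\<close>
  define V where "V x = T x - cos (c * x) / (2 * c * sin (x/2))" for x :: real
  have c: "0 < c" by (simp add: c_def)
  have "a \<le> pi" using a by simp
  then have s: "0 < s" unfolding s_def using a by (intro sin_gt_zero) auto
  have sin_ge: "s \<le> sin (y/2)" if "y \<in> {a..2 * pi - a}" for y
  proof (cases "y \<le> pi")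
    case True
    then show ?thesis unfolding s_def using that a by (intro sin_monotone_2pi_le) auto
  next
    case False
    have "s \<le> sin (pi - y/2)" unfolding s_def using that a False by (intro sin_monotone_2pi_le) auto
    then show ?thesis by simp
  qed
  have pi_in: "pi \<in> {a..2 * pi - a}" using \<open>a \<le> pi\<close> by auto
  have T_deriv: "(T has_field_derivative - (1/2 + (\<Sum>n<H. cos (real (Suc n) * y)))) (at y within S)" for y S
    unfolding T_def
    by (rule derivative_eq_intros refl | simp add: sum_negf)+
  have V_deriv: "(V has_field_derivative cos (c * y) * cos (y/2) / (4 * c * (sin (y/2))\<^sup>2))
      (at y within {a..2 * pi - a})" if y: "y \<in> {a..2 * pi - a}" for y
  proof -
    have nz: "sin (y/2) \<noteq> 0" using sin_ge[OF y] s by auto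
    have k: "1/2 + (\<Sum>n<H. cos (real (Suc n) * y)) = sin (c * y) / (2 * sin (y/2))"
      using dirichlet_kernel[of y H] nz by (simp add: field_simps c_def)
    have q: "((\<lambda>y. cos (c * y) / (2 * c * sin (y/2))) has_field_derivative
        - sin (c * y) / (2 * sin (y/2)) - cos (c * y) * cos (y/2) / (4 * c * (sin (y/2))\<^sup>2))
      (at y within {a..2 * pi - a})"
      using c nz
      by (auto intro!: derivative_eq_intros simp: divide_simps power2_eq_square)
        (simp add: algebra_simps)
    show ?thesis unfolding V_def
      by (rule DERIV_cong[OF DERIV_diff[OF T_deriv q]]) (unfold k, simp)
  qed
  have "\<bar>V x - V pi\<bar> \<le> 1 / (4 * c * s\<^sup>2) * \<bar>x - pi\<bar>"
  proof -
    have "norm (V x - V pi) \<le> 1 / (4 * c * s\<^sup>2) * norm (x - pi)"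
    proof (rule field_differentiable_bound[OF _ V_deriv])
      fix y assume y: "y \<in> {a..2 * pi - a}"
      have "s\<^sup>2 \<le> (sin (y/2))\<^sup>2" using sin_ge[OF y] s by (intro power_mono) auto
      moreover have "\<bar>cos (c * y)\<bar> * \<bar>cos (y/2)\<bar> \<le> 1 * 1" by (intro mult_mono) auto
      ultimately show "norm (cos (c * y) * cos (y/2) / (4 * c * (sin (y/2))\<^sup>2)) \<le> 1 / (4 * c * s\<^sup>2)"
        using c s by (simp add: abs_mult abs_divide, intro frac_le mult_left_mono) auto
    qed (use a pi_in in auto)
    then show ?thesis by simp
  qed
  also have "\<dots> \<le> 1 / (4 * c * s\<^sup>2) * pi"
    using a c s by (intro mult_left_mono) auto
  finally have V: "\<bar>V x - V pi\<bar> \<le> pi / (4 * s\<^sup>2) / c" using c s by (simp add: field_simps)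
  have "T pi = 0" by (simp add: T_def sin_npi del: of_nat_Suc)
  then have "\<bar>V pi\<bar> \<le> (1/2) / c" using c by (simp add: V_def abs_mult abs_divide field_simps)
  moreover have "\<bar>T x - V x\<bar> \<le> 1 / (2 * s) / c"
  proof -
    have "\<bar>T x - V x\<bar> = \<bar>cos (c * x)\<bar> / (2 * c * \<bar>sin (x/2)\<bar>)"
      using c by (simp add: V_def abs_mult abs_divide)
    also have "\<dots> \<le> 1 / (2 * c * s)"
      using sin_ge[of x] a c s by (intro frac_le mult_left_mono) auto
    finally show ?thesis by (simp add: mult_ac)
  qed
  ultimately have "\<bar>T x\<bar> \<le> pi / (4 * s\<^sup>2) / c + 1 / (2 * s) / c + (1/2) / c" using V by linarith
  then show ?thesis unfolding T_def s_def c_def by (simp only: add_divide_distrib)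
qed

lemma summable_inverse_Suc_squares: "summable (\<lambda>n. 1 / (real (Suc n))\<^sup>2)"
  using inverse_squares_sums by (auto simp: sums_iff)

lemma summable_cos_over_squares: "summable (\<lambda>n. cos (real (Suc n) * x) / (real (Suc n))\<^sup>2)"
  by (rule summable_comparison_test[OF _ summable_inverse_Suc_squares])
    (auto simp: abs_divide intro!: divide_right_mono exI[of _ 0])

text \<open>
  The derivative of the partial sums of \<open>\<Sum> cos (n x) / n\<^sup>2\<close>, minus that of \<open>x\<^sup>2/4 - \<pi> x / 2\<close>, tends to \<open>0\<close>
  uniformly on compact subsets of \<open>(0, 2 \<pi>)\<close> by \<open>sine_series_error\<close>. Hence the sum of the series and this
  polynomial differ by a constant there, and up to the end points by continuity. Subtracting the value at \<open>0\<close> removes the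
  constant.
\<close>

lemma cosine_series:
  fixes x :: real
  assumes "0 \<le> x" "x \<le> 2 * pi"
  shows "(\<lambda>n. (cos (real (Suc n) * x) - 1) / (real (Suc n))\<^sup>2) sums (x\<^sup>2 / 4 - pi * x / 2)"
proof -
  define G where "G x = (\<Sum>n. cos (real (Suc n) * x) / (real (Suc n))\<^sup>2)" for x :: real
  define R where "R x = G x - x\<^sup>2 / 4 + pi * x / 2" for x :: real
  define Rp where "Rp H x = (\<Sum>n<H. cos (real (Suc n) * x) / (real (Suc n))\<^sup>2) - x\<^sup>2 / 4 + pi * x / 2" for H and x :: real
  have unif: "uniform_limit UNIV (\<lambda>H x::real. \<Sum>n<H. cos (real (Suc n) * x) / (real (Suc n))\<^sup>2) G sequentially"
    unfolding G_def
    by (rule Weierstrass_m_test[OF _ summable_inverse_Suc_squares])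
      (auto simp: abs_divide intro!: divide_right_mono)
  have cont: "continuous_on UNIV G"
    by (rule uniform_limit_theorem[OF _ unif]) (auto intro!: always_eventually continuous_intros)
  have Rp_lim: "(\<lambda>H. Rp H x) \<longlonglongrightarrow> R x" for x
    unfolding Rp_def R_def by (intro tendsto_intros tendsto_uniform_limitI[OF unif]) auto
  have R_eq: "R x = R y" if xy: "x \<in> {0<..<2 * pi}" "y \<in> {0<..<2 * pi}" for x y :: real
  proof -
    define a where "a = Min {x, y, 2 * pi - x, 2 * pi - y}"
    have a: "0 < a" "a \<le> x" "x \<le> 2 * pi - a" "a \<le> y" "y \<le> 2 * pi - a"
      using xy by (auto simp: a_def)
    define C where "C = pi / (4 * (sin (a/2))\<^sup>2) + 1 / (2 * sin (a/2)) + 1/2"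
    have bound: "\<bar>Rp H x - Rp H y\<bar> \<le> C / (H + 1/2) * \<bar>x - y\<bar>" for H
    proof -
      have "norm (Rp H x - Rp H y) \<le> C / (H + 1/2) * norm (x - y)"
      proof (rule field_differentiable_bound)
        fix z assume z: "z \<in> {a..2 * pi - a}"
        have term_deriv: "((\<lambda>x. cos (k * x) / k\<^sup>2) has_field_derivative - (sin (k * z) / k)) (at z within S)"
          if "0 < k" for k S
          using that by (auto intro!: derivative_eq_intros simp: power2_eq_square)
        have "(Rp H has_field_derivative (\<Sum>n<H. - (sin (real (Suc n) * z) / real (Suc n))) - z / 2 + pi / 2)
            (at z within {a..2 * pi - a})"
          unfolding Rp_def
          by (rule DERIV_add DERIV_diff DERIV_sum term_deriv | (auto intro!: derivative_eq_intros)[1])+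
        then show "(Rp H has_field_derivative (pi - z) / 2 - (\<Sum>n<H. sin (real (Suc n) * z) / real (Suc n)))
            (at z within {a..2 * pi - a})"
          by (rule DERIV_cong) (simp add: sum_negf diff_divide_distrib)
        show "norm ((pi - z) / 2 - (\<Sum>n<H. sin (real (Suc n) * z) / real (Suc n))) \<le> C / (H + 1/2)"
          using sine_series_error[of a z H] a z by (simp add: C_def)
      qed (use a in auto)
      then show ?thesis by simp
    qed
    have "(\<lambda>H. C / (real H + 1/2) * \<bar>x - y\<bar>) \<longlonglongrightarrow> 0"
      by real_asymp
    then have "(\<lambda>H. Rp H x - Rp H y) \<longlonglongrightarrow> 0"
      by (rule Lim_null_comparison[rotated]) (use bound in auto)
    moreover have "(\<lambda>H. Rp H x - Rp H y) \<longlonglongrightarrow> R x - R y" by (intro tendsto_diff Rp_lim)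
    ultimately have "R x - R y = 0" using LIMSEQ_unique by blast
    then show ?thesis by simp
  qed
  have cR: "continuous_on (closure {0<..<2 * pi}) R"
    unfolding R_def by (intro continuous_intros continuous_on_subset[OF cont]) auto
  have R_pi: "R y = R pi" if "y \<in> closure {0<..<2 * pi}" for y
    by (rule continuous_constant_on_closure[OF cR _ that], rule R_eq) auto
  have "R x = R pi" "R 0 = R pi" using assms by (auto intro!: R_pi)
  then have "G x - G 0 = x\<^sup>2 / 4 - pi * x / 2" by (simp add: R_def)
  moreover have "(\<lambda>n. cos (real (Suc n) * x) / (real (Suc n))\<^sup>2 - cos (real (Suc n) * 0) / (real (Suc n))\<^sup>2) sums (G x - G 0)"
    unfolding G_def by (intro sums_diff summable_sums summable_cos_over_squares)
  ultimately show ?thesis by (simp add: diff_divide_distrib)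
qed

definition sawtooth :: "real \<Rightarrow> real"
  where "sawtooth x = frac x - 1/2"

text \<open>
  The periodic primitive of the sawtooth that vanishes at the integers. It takes values in \<open>[-1/8, 0]\<close>.
\<close>

definition sawtooth_integral :: "real \<Rightarrow> real"
  where "sawtooth_integral x = ((frac x)\<^sup>2 - frac x) / 2"

lemma sawtooth_integral_fourier:
  "(\<lambda>n. (cos (2 * pi * real (Suc n) * x) - 1) / (real (Suc n))\<^sup>2) sums (2 * pi\<^sup>2 * sawtooth_integral x)"
proof -
  have "cos (2 * pi * real (Suc n) * x) = cos (real (Suc n) * (2 * pi * frac x))" for n
  proof -
    have "2 * pi * real (Suc n) * x = real (Suc n) * (2 * pi * frac x) + 2 * pi * real_of_int (int (Suc n) * \<lfloor>x\<rfloor>)"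
      by (simp add: frac_def algebra_simps)
    then show ?thesis by (simp only: cos_add sin_int_2pin cos_int_2pin)
  qed
  moreover have "(\<lambda>n. (cos (real (Suc n) * (2 * pi * frac x)) - 1) / (real (Suc n))\<^sup>2) sums
      ((2 * pi * frac x)\<^sup>2 / 4 - pi * (2 * pi * frac x) / 2)"
    by (rule cosine_series) (auto simp: frac_lt_1 less_imp_le)
  moreover have "(2 * pi * frac x)\<^sup>2 / 4 - pi * (2 * pi * frac x) / 2 = 2 * pi\<^sup>2 * sawtooth_integral x"
    by (simp add: sawtooth_integral_def power2_eq_square algebra_simps)
  ultimately show ?thesis by simp
qed

lemma sawtooth_integral_eq:
  assumes "y = x - of_int k" "0 \<le> y" "y < 1"
  shows "sawtooth_integral x = (y\<^sup>2 - y) / 2"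
proof -
  have "frac x = y" unfolding frac_unique_iff using assms by simp
  then show ?thesis by (simp add: sawtooth_integral_def)
qed

lemma int_mult_pred_nonneg: "0 \<le> (k::int) * (k - 1)"
  by (cases "k \<le> 0") (auto simp: mult_nonpos_nonpos)

text \<open>
  The sawtooth increases with slope \<open>1\<close> and only jumps downwards, so \<open>\<psi>(x + t) \<le> \<psi>(x) + t\<close> for
  \<open>t \<ge> 0\<close>. The claim is this inequality integrated over \<open>0 \<le> t \<le> \<eta>\<close>; the proof compares the primitives
  directly, \<open>k\<close> being the number of jumps between \<open>x\<close> and \<open>x + \<eta>\<close>.
\<close>

lemma sawtooth_lower:
  assumes "0 < \<eta>"
  shows "sawtooth_integral (x + \<eta>) - sawtooth_integral x \<le> \<eta> * sawtooth x + \<eta>\<^sup>2 / 2"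
proof -
  define a where "a = frac x"
  define k where "k = \<lfloor>a + \<eta>\<rfloor>"
  define y where "y = a + \<eta> - k"
  have a: "0 \<le> a" by (simp add: a_def)
  have k0: "0 \<le> k" unfolding k_def using a assms by simp
  have y: "0 \<le> y" "y < 1" unfolding y_def k_def by linarith+
  have "sawtooth_integral (x + \<eta>) = (y\<^sup>2 - y) / 2"
    by (rule sawtooth_integral_eq[OF _ y, where k = "\<lfloor>x\<rfloor> + k"]) (simp add: y_def a_def frac_def)
  moreover have "0 \<le> real_of_int (k * (k - 1))" using int_mult_pred_nonneg[of k] by (simp only: of_int_0_le_iff)
  then have "0 \<le> real_of_int k * (real_of_int k - 1) + 2 * real_of_int k * y"
    using y k0 by simp
  then have "y\<^sup>2 - y \<le> (a + \<eta>)\<^sup>2 - (a + \<eta>)"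
    by (simp add: y_def power2_eq_square algebra_simps)
  ultimately show ?thesis
    by (simp add: sawtooth_integral_def sawtooth_def power2_eq_square flip: a_def)
      (simp add: algebra_simps diff_divide_distrib add_divide_distrib)
qed

lemma sawtooth_upper:
  assumes "0 < \<eta>"
  shows "\<eta> * sawtooth x - \<eta>\<^sup>2 / 2 \<le> sawtooth_integral x - sawtooth_integral (x - \<eta>)"
proof -
  define a where "a = frac x"
  define k where "k = - \<lfloor>a - \<eta>\<rfloor>"
  define y where "y = a - \<eta> + k"
  have a: "a < 1" by (simp add: a_def frac_lt_1)
  have k0: "0 \<le> k" unfolding k_def using a assms by simp
  have y: "0 \<le> y" "y < 1" unfolding y_def k_def by linarith+
  have "sawtooth_integral (x - \<eta>) = (y\<^sup>2 - y) / 2"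
    by (rule sawtooth_integral_eq[OF _ y, where k = "\<lfloor>x\<rfloor> - k"]) (simp add: y_def a_def frac_def)
  moreover have "0 \<le> real_of_int (k * (k - 1))" using int_mult_pred_nonneg[of k] by (simp only: of_int_0_le_iff)
  then have "0 \<le> real_of_int k * (real_of_int k - 1) + 2 * real_of_int k * (1 - y)"
    using y k0 by simp
  then have "y\<^sup>2 - y \<le> (a - \<eta>)\<^sup>2 - (a - \<eta>)"
    by (simp add: y_def power2_eq_square algebra_simps)
  ultimately show ?thesis
    by (simp add: sawtooth_integral_def sawtooth_def power2_eq_square flip: a_def)
      (simp add: algebra_simps diff_divide_distrib add_divide_distrib)
qed

lemma sqrt_tangent:
  assumes "0 \<le> x" "x \<le> y" "0 < y"
  shows "(y - x) / sqrt y \<le> 2 * sqrt y - 2 * sqrt x"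
proof -
  define p q where "p = sqrt x" and "q = sqrt y"
  have pq: "x = p * p" "y = q * q" "0 \<le> p" "p \<le> q" "0 < q" using assms by (auto simp: p_def q_def)
  have "(q - p) * (q + p) \<le> (q - p) * (2 * q)" using pq by (intro mult_left_mono) auto
  then have "q * q - p * p \<le> (2 * q - 2 * p) * q" by (simp add: algebra_simps)
  then show ?thesis using pq unfolding p_def[symmetric] q_def[symmetric] by (simp add: divide_le_eq)
qed

lemma inverse_sqrt_tangent:
  assumes "0 < x" "x \<le> y"
  shows "(y - x) / (y * sqrt y) \<le> 2 / sqrt x - 2 / sqrt y"
proof -
  define p q where "p = sqrt x" and "q = sqrt y"
  have pq: "x = p * p" "y = q * q" "0 < p" "p \<le> q" "0 < q" using assms by (auto simp: p_def q_def)
  have "(q + p) * p \<le> (2 * q) * q" using pq by (intro mult_mono) auto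
  then have "(q - p) * ((q + p) * p) \<le> (q - p) * (2 * q * q)" using pq by (intro mult_left_mono) auto
  then have "(q * q - p * p) / (q * q * q) \<le> 2 / p - 2 / q"
    using pq by (simp add: divide_simps) (simp add: algebra_simps)
  then show ?thesis using pq unfolding p_def[symmetric] q_def[symmetric] by simp
qed

text \<open>
  The summand \<open>min H h / h\<^sup>3\<^sup>/\<^sup>2\<close> is a decreasing function of \<open>h\<close>, so the sum is at most its integral over
  \<open>[0, N]\<close>. This integral is the function \<open>\<phi>\<close> of the proof.
\<close>

lemma truncated_weights_sum:
  fixes H :: real
  assumes H: "0 < H"
  shows "(\<Sum>n<N. min H (Suc n) / (real (Suc n))\<^sup>2 * sqrt (Suc n)) \<le> 4 * sqrt H"
proof -
  define \<phi> where "\<phi> x = (if x \<le> H then 2 * sqrt x else 4 * sqrt H - 2 * H / sqrt x)" for x :: real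
  have "(\<Sum>n<N. min H (Suc n) / (real (Suc n))\<^sup>2 * sqrt (Suc n)) \<le> \<phi> N"
  proof (induction N)
    case 0
    then show ?case using H by (simp add: \<phi>_def)
  next
    case (Suc N)
    define h where "h = real (Suc N)"
    have h: "0 < h" "real N = h - 1" by (auto simp: h_def)
    have sq: "sqrt h / h\<^sup>2 = 1 / (h * sqrt h)"
      using h by (simp add: divide_simps power2_eq_square)
    consider "h \<le> H" | "H \<le> real N" | "real N < H" "H < h" by linarith
    then have "min H h / h\<^sup>2 * sqrt h \<le> \<phi> h - \<phi> (real N)"
    proof cases
      case 1
      have "min H h / h\<^sup>2 * sqrt h = (h - (h - 1)) / sqrt h"
        using 1 h sq by (simp add: min_def field_simps power2_eq_square)
      also have "\<dots> \<le> 2 * sqrt h - 2 * sqrt (h - 1)"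
        using h by (intro sqrt_tangent) auto
      finally show ?thesis using 1 h by (simp add: \<phi>_def)
    next
      case 2
      have "min H h / h\<^sup>2 * sqrt h = H * (sqrt h / h\<^sup>2)"
        using 2 h by (simp add: min_def)
      also have "\<dots> = H * ((h - (h - 1)) / (h * sqrt h))" unfolding sq by simp
      also have "\<dots> \<le> H * (2 / sqrt (h - 1) - 2 / sqrt h)"
        using 2 h H by (intro mult_left_mono inverse_sqrt_tangent) auto
      also have "\<dots> = \<phi> h - \<phi> (real N)"
      proof (cases "real N = H")
        case True
        moreover have "H * (2 / sqrt H) = 2 * sqrt H"
          using arg_cong[OF real_div_sqrt[of H], of "\<lambda>t. 2 * t"] H by (simp add: mult.commute)
        ultimately show ?thesis using h H by (simp add: \<phi>_def right_diff_distrib)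
      next
        case False
        then show ?thesis using 2 h by (simp add: \<phi>_def algebra_simps)
      qed
      finally show ?thesis .
    next
      case 3
      have "min H h / h\<^sup>2 * sqrt h = H * ((h - H) / (h * sqrt h)) + (H - (h - 1)) * (H / (h * sqrt h))"
      proof -
        have "min H h / h\<^sup>2 * sqrt h = H * (sqrt h / h\<^sup>2)"
          using 3 by (simp add: min_def)
        also have "\<dots> = (h - H + (H - (h - 1))) * (H * (1 / (h * sqrt h)))" unfolding sq by simp
        also have "\<dots> = H * ((h - H) / (h * sqrt h)) + (H - (h - 1)) * (H / (h * sqrt h))"
          by (simp only: distrib_right times_divide_eq_left times_divide_eq_right mult_1_right mult.commute[of H] add_divide_distrib)
        finally show ?thesis .
      qed
      also have "H * ((h - H) / (h * sqrt h)) \<le> H * (2 / sqrt H - 2 / sqrt h)"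
        using 3 H by (intro mult_left_mono inverse_sqrt_tangent) auto
      also have "(H - (h - 1)) * (H / (h * sqrt h)) \<le> (H - (h - 1)) * (1 / sqrt H)"
      proof (intro mult_left_mono)
        have "H * sqrt H \<le> h * sqrt h" using 3 H by (intro mult_mono) auto
        then show "H / (h * sqrt h) \<le> 1 / sqrt H" using H h by (simp add: divide_simps)
      qed (use 3 h in auto)
      also have "(H - (h - 1)) * (1 / sqrt H) \<le> 2 * sqrt H - 2 * sqrt (h - 1)"
        using sqrt_tangent[of "h - 1" H] 3 H h by auto
      finally have "min H h / h\<^sup>2 * sqrt h \<le> H * (2 / sqrt H - 2 / sqrt h) + (2 * sqrt H - 2 * sqrt (h - 1))"
        by simp
      also have "\<dots> = \<phi> h - \<phi> (real N)"
      proof -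
        have "H * (2 / sqrt H) = 2 * sqrt H"
          using arg_cong[OF real_div_sqrt[of H], of "\<lambda>t. 2 * t"] H by (simp add: mult.commute)
        then show ?thesis using 3 h by (simp add: \<phi>_def right_diff_distrib)
      qed
      finally show ?thesis .
    qed
    then show ?case using Suc by (simp add: h_def)
  qed
  also have "\<phi> N \<le> 4 * sqrt H"
  proof (cases "real N \<le> H")
    case True
    then have "sqrt N \<le> sqrt H" by simp
    moreover have "0 \<le> sqrt H" using H by simp
    ultimately have "2 * sqrt N \<le> 4 * sqrt H" by linarith
    then show ?thesis using True by (simp add: \<phi>_def)
  qed (use H in \<open>simp add: \<phi>_def\<close>)
  finally show ?thesis .
qed

section \<open>Sums of the sawtooth function along a curve\<close>

lemma norm_cis_minus_one_le: "norm (cis t - 1) \<le> min 2 \<bar>t\<bar>"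
proof -
  have "norm (cis t - 1) = 2 * \<bar>sin (t / 2)\<bar>"
    using dist_exp_i_1[of t] by (simp add: cis_conv_exp)
  moreover have "\<bar>sin (t / 2)\<bar> \<le> 1" "\<bar>sin (t / 2)\<bar> \<le> \<bar>t / 2\<bar>"
    using abs_sin_x_le_abs_x[of "t / 2"] by auto
  ultimately show ?thesis unfolding min_def by auto
qed

text \<open>
  By \<open>sawtooth_lower\<close> and \<open>sawtooth_upper\<close> the sawtooth is squeezed between difference quotients of its
  primitive at the scale \<open>\<eta> = 1 / (\<pi> H)\<close>, at the cost of \<open>\<eta> / 2\<close> per term. Inserting the Fourier series,
  the shift by \<open>\<eta>\<close> turns the \<open>h\<close>-th exponential sum into itself times \<open>e(\<plusminus> h \<eta>) - 1\<close>, which is bounded by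
  \<open>min 2 (2 h / H)\<close>. With the factor \<open>1 / h\<^sup>2\<close> of the series this is a multiple of the weight in
  \<open>truncated_weights_sum\<close>.
\<close>

lemma sawtooth_sum_le_exponential_sums:
  fixes u :: "nat \<Rightarrow> real" and H A B :: real
  assumes H: "0 < H" and AB: "0 \<le> A" "0 \<le> B"
    and S: "\<And>n. norm (\<Sum>j<K. cis (2 * pi * (real (Suc n) * u j)))
      \<le> A * sqrt (real (Suc n)) + B / sqrt (real (Suc n))"
  shows "\<bar>\<Sum>j<K. sawtooth (u j)\<bar> \<le> K / (2 * pi * H) + (4 * A * sqrt H + 4 * B) / pi"
proof -
  define \<eta> where "\<eta> = 1 / (pi * H)"
  define Z where "Z = 4 * A * sqrt H + 4 * B"
  have \<eta>: "0 < \<eta>" using H by (simp add: \<eta>_def)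
  define w where "w H n = min H (real (Suc n)) / (real (Suc n))\<^sup>2 * sqrt (real (Suc n))" for H n
  have w_nonneg: "0 \<le> w H n" if "0 < H" for H n using that by (simp add: w_def)
  have w_summable: "summable (w H)" if "0 < H" for H
    using truncated_weights_sum[OF that] w_nonneg[OF that]
    by (intro summableI_nonneg_bounded[of _ "4 * sqrt H"]) (auto simp: w_def)
  have w_suminf: "suminf (w H) \<le> 4 * sqrt H" if "0 < H" for H
    using truncated_weights_sum[OF that] by (intro suminf_le_const w_summable that) (auto simp: w_def)
  have shift: "\<bar>\<Sum>j<K. sawtooth_integral (u j + \<sigma>) - sawtooth_integral (u j)\<bar> \<le> \<eta> / pi * Z"
    if \<sigma>: "\<bar>\<sigma>\<bar> = \<eta>" for \<sigma>
  proof -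
    define c where "c n = (\<Sum>j<K. (cos (2 * pi * real (Suc n) * (u j + \<sigma>)) - 1) / (real (Suc n))\<^sup>2
        - (cos (2 * pi * real (Suc n) * u j) - 1) / (real (Suc n))\<^sup>2)" for n
    have c_sums: "c sums (\<Sum>j<K. 2 * pi\<^sup>2 * sawtooth_integral (u j + \<sigma>) - 2 * pi\<^sup>2 * sawtooth_integral (u j))"
      unfolding c_def by (intro sums_sum sums_diff sawtooth_integral_fourier)
    have c_le: "\<bar>c n\<bar> \<le> 2 / H * (A * w H n + B * w 1 n)" for n
    proof -
      define h where "h = real (Suc n)"
      have h: "1 \<le> h" by (simp add: h_def)
      let ?T = "\<Sum>j<K. cis (2 * pi * (h * u j))"
      have "c n = (\<Sum>j<K. cos (2 * pi * h * (u j + \<sigma>)) - cos (2 * pi * h * u j)) / h\<^sup>2"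
        unfolding c_def h_def[symmetric] by (simp add: sum_divide_distrib diff_divide_distrib)
      also have "(\<Sum>j<K. cos (2 * pi * h * (u j + \<sigma>)) - cos (2 * pi * h * u j))
          = Re ((cis (2 * pi * h * \<sigma>) - 1) * ?T)"
        unfolding sum_distrib_left Re_sum
        by (intro sum.cong refl) (simp add: left_diff_distrib cis_mult algebra_simps)
      finally have "\<bar>c n\<bar> = \<bar>Re ((cis (2 * pi * h * \<sigma>) - 1) * ?T)\<bar> / h\<^sup>2"
        by (simp add: abs_divide)
      also have "\<bar>Re ((cis (2 * pi * h * \<sigma>) - 1) * ?T)\<bar> \<le> norm (cis (2 * pi * h * \<sigma>) - 1) * norm ?T"
        using abs_Re_le_cmod[of "(cis (2 * pi * h * \<sigma>) - 1) * ?T"] by (simp add: norm_mult)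
      also have "\<dots> \<le> (2 / H * min H h) * (A * sqrt h + B / sqrt h)"
      proof (intro mult_mono)
        have "\<bar>2 * pi * h * \<sigma>\<bar> = 2 / H * h"
          using \<sigma> h H by (simp add: abs_mult \<eta>_def)
        then show "norm (cis (2 * pi * h * \<sigma>) - 1) \<le> 2 / H * min H h"
          using norm_cis_minus_one_le[of "2 * pi * h * \<sigma>"] H by (simp add: min_mult_distrib_left)
        show "norm ?T \<le> A * sqrt h + B / sqrt h" unfolding h_def by (rule S)
      qed (use H h in auto)
      finally have "\<bar>c n\<bar> \<le> (2 / H * min H h) * (A * sqrt h + B / sqrt h) / h\<^sup>2"
        using h by (simp add: divide_right_mono)
      also have "\<dots> = 2 / H * (A * (min H h / h\<^sup>2 * sqrt h) + B * (min H h / h\<^sup>2 / sqrt h))"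
        by (simp add: algebra_simps add_divide_distrib)
      also have "\<dots> \<le> 2 / H * (A * w H n + B * w 1 n)"
      proof -
        \<comment> \<open>the weight \<open>h / h\<^sup>2 / sqrt h\<close> equals \<open>w 1\<close>, so one summation lemma serves both terms\<close>
        have "min H h / h\<^sup>2 / sqrt h \<le> h / h\<^sup>2 / sqrt h"
          using h by (intro divide_right_mono) auto
        also have "\<dots> = h / sqrt h / h\<^sup>2" by simp
        also have "\<dots> = w 1 n"
          unfolding w_def h_def[symmetric] using h by (simp add: real_div_sqrt)
        finally show ?thesis using AB H
          by (intro mult_left_mono add_mono) (auto simp: w_def h_def)
      qed
      finally show ?thesis .
    qed
    have "summable (\<lambda>n. 2 / H * (A * w H n + B * w 1 n))"
      using H by (intro summable_mult summable_add w_summable) auto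
    then have "\<bar>suminf c\<bar> \<le> (\<Sum>n. 2 / H * (A * w H n + B * w 1 n))"
      using c_le norm_suminf_le[of c] by simp
    also have "\<dots> = 2 / H * (A * suminf (w H) + B * suminf (w 1))"
      using H by (intro sums_unique[symmetric] sums_mult sums_add summable_sums w_summable) auto
    also have "\<dots> \<le> 2 / H * (A * (4 * sqrt H) + B * (4 * sqrt 1))"
      using H AB w_suminf[of H] w_suminf[of 1] by (intro mult_left_mono add_mono) auto
    also have "\<dots> = 2 / H * Z" by (simp add: Z_def algebra_simps)
    also have "suminf c = 2 * pi\<^sup>2 * (\<Sum>j<K. sawtooth_integral (u j + \<sigma>) - sawtooth_integral (u j))"
      using sums_unique[OF c_sums] by (simp add: sum_distrib_left right_diff_distrib)
    finally have "2 * pi\<^sup>2 * \<bar>\<Sum>j<K. sawtooth_integral (u j + \<sigma>) - sawtooth_integral (u j)\<bar> \<le> 2 / H * Z"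
      by (simp add: abs_mult)
    then have "\<bar>\<Sum>j<K. sawtooth_integral (u j + \<sigma>) - sawtooth_integral (u j)\<bar> \<le> 2 / H * Z / (2 * pi\<^sup>2)"
      by (subst pos_le_divide_eq) (auto simp: mult.commute)
    also have "\<dots> = \<eta> / pi * Z" by (simp add: \<eta>_def power2_eq_square)
    finally show ?thesis .
  qed
  let ?P = sawtooth_integral
  have "\<eta> * (\<Sum>j<K. sawtooth (u j)) \<le> (\<Sum>j<K. \<eta>\<^sup>2 / 2 - (?P (u j + (- \<eta>)) - ?P (u j)))"
    unfolding sum_distrib_left using sawtooth_upper[OF \<eta>] by (intro sum_mono) (simp add: algebra_simps)
  also have "\<dots> = K * (\<eta>\<^sup>2 / 2) - (\<Sum>j<K. ?P (u j + (- \<eta>)) - ?P (u j))"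
    by (simp add: sum_subtractf)
  also have "\<dots> \<le> K * (\<eta>\<^sup>2 / 2) + \<eta> / pi * Z"
    using shift[of "- \<eta>"] \<eta> by (auto simp: abs_le_iff)
  also have "\<dots> = \<eta> * (K * \<eta> / 2 + Z / pi)" by (simp add: power2_eq_square algebra_simps)
  finally have upper: "(\<Sum>j<K. sawtooth (u j)) \<le> K * \<eta> / 2 + Z / pi" using \<eta> by simp
  have "\<eta> * (- (K * \<eta> / 2 + Z / pi)) = - (\<eta> / pi * Z) - K * (\<eta>\<^sup>2 / 2)"
    by (simp add: power2_eq_square algebra_simps)
  also have "\<dots> \<le> (\<Sum>j<K. ?P (u j + \<eta>) - ?P (u j)) - K * (\<eta>\<^sup>2 / 2)"
    using shift[of \<eta>] \<eta> by (auto simp: abs_le_iff)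
  also have "\<dots> = (\<Sum>j<K. (?P (u j + \<eta>) - ?P (u j)) - \<eta>\<^sup>2 / 2)"
    by (simp add: sum_subtractf)
  also have "\<dots> \<le> \<eta> * (\<Sum>j<K. sawtooth (u j))"
    unfolding sum_distrib_left
    by (intro sum_mono, subst diff_le_eq) (rule sawtooth_lower[OF \<eta>])
  finally have lower: "- (K * \<eta> / 2 + Z / pi) \<le> (\<Sum>j<K. sawtooth (u j))" using \<eta> by simp
  have "\<bar>\<Sum>j<K. sawtooth (u j)\<bar> \<le> K * \<eta> / 2 + Z / pi" using upper lower by linarith
  then show ?thesis by (simp add: \<eta>_def Z_def)
qed

text \<open>
  The exponential sums are those of \<open>h u\<close>, whose second differences are of size \<open>h \<Lambda>\<close>. The resulting
  bound \<open>K / (2 \<pi> H) + (40 / \<pi>) K (\<Lambda> H)\<^sup>1\<^sup>/\<^sup>2 + O(\<Lambda>\<^sup>-\<^sup>1\<^sup>/\<^sup>2)\<close> is nearly minimal for \<open>H = (4/49) \<Lambda>\<^sup>-\<^sup>1\<^sup>/\<^sup>3\<close>, a value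
  whose square root is rational up to a power of \<open>\<Lambda>\<close>. All terms are expressed in \<open>p = \<Lambda>\<^sup>1\<^sup>/\<^sup>6\<close>.
\<close>

lemma sawtooth_sum_second_differences:
  fixes u :: "nat \<Rightarrow> real"
  assumes \<Lambda>: "0 < \<Lambda>" "\<Lambda> \<le> 1" and K: "K \<le> N + 1" "0 \<le> N"
    and lower: "\<And>n. n + 2 < K \<Longrightarrow> \<Lambda> \<le> 2 * u (n + 1) - u n - u (n + 2)"
    and upper: "\<And>n. n + 2 < K \<Longrightarrow> 2 * u (n + 1) - u n - u (n + 2) \<le> 2 * \<Lambda>"
  shows "\<bar>\<Sum>j<K. sawtooth (u j)\<bar> \<le> 6 * N * \<Lambda> powr (1/3) + 21 / sqrt \<Lambda>"
proof -
  define p where "p = \<Lambda> powr (1/6)"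
  have p: "0 < p" using \<Lambda> by (simp add: p_def)
  have p2: "\<Lambda> powr (1/3) = p\<^sup>2"
    using powr_add[of \<Lambda> "1/6" "1/6"] by (simp add: p_def power2_eq_square)
  have p3: "sqrt \<Lambda> = p ^ 3"
    using powr_add[of \<Lambda> "1/6" "1/6"] powr_add[of \<Lambda> "1/3" "1/6"] \<Lambda>
    by (simp add: p_def power3_eq_cube flip: powr_half_sqrt)
  have p_le: "p \<le> 1" using \<Lambda> powr_mono2[of "1/6" \<Lambda> 1] by (simp add: p_def)
  define H where "H = 4 / 49 / p\<^sup>2"
  have H: "0 < H" using p by (simp add: H_def)
  have sqrt_H: "sqrt H = 2 / 7 / p"
    unfolding H_def using p by (intro real_sqrt_unique) (auto simp: power_divide power2_eq_square)
  have "\<bar>\<Sum>j<K. sawtooth (u j)\<bar> \<le> K / (2 * pi * H) + (4 * (10 * real K * sqrt \<Lambda>) * sqrt H + 4 * (11 / sqrt \<Lambda>)) / pi"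
  proof (rule sawtooth_sum_le_exponential_sums[OF H])
    fix n
    define h where "h = real (Suc n)"
    have h: "0 < h" by (simp add: h_def)
    have "norm (\<Sum>j<K. cis (2 * pi * (h * u j))) \<le> 10 * real K * sqrt (h * \<Lambda>) + 11 / sqrt (h * \<Lambda>)"
    proof (rule van_der_corput_second_difference)
      fix n assume n: "n + 2 < K"
      have e: "2 * (h * u (n + 1)) - h * u n - h * u (n + 2) = h * (2 * u (n + 1) - u n - u (n + 2))"
        by (simp add: algebra_simps)
      show "h * \<Lambda> \<le> 2 * (h * u (n + 1)) - h * u n - h * u (n + 2)"
        unfolding e using lower[OF n] h by (intro mult_left_mono) auto
      have "h * (2 * u (n + 1) - u n - u (n + 2)) \<le> h * (2 * \<Lambda>)"
        using upper[OF n] h by (intro mult_left_mono) auto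
      then show "2 * (h * u (n + 1)) - h * u n - h * u (n + 2) \<le> 2 * (h * \<Lambda>)"
        unfolding e by simp
    qed (use h \<Lambda> in auto)
    then show "norm (\<Sum>j<K. cis (2 * pi * (real (Suc n) * u j)))
      \<le> 10 * real K * sqrt \<Lambda> * sqrt (real (Suc n)) + 11 / sqrt \<Lambda> / sqrt (real (Suc n))"
      unfolding h_def by (simp add: real_sqrt_mult mult_ac)
  qed (use \<Lambda> in auto)
  also have "\<dots> = (983 / 56 * (K * p\<^sup>2) + 44 / p ^ 3) / pi"
    unfolding sqrt_H p3 unfolding H_def using p by (simp add: field_simps power2_eq_square power3_eq_cube)
  also have "\<dots> \<le> (18 * (K * p\<^sup>2) + 44 / p ^ 3) / 3"
    using p pi_gt3 by (intro frac_le add_mono mult_right_mono) auto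
  also have "\<dots> = 6 * (K * p\<^sup>2) + 44 / 3 / p ^ 3" by (simp add: field_simps)
  also have "\<dots> \<le> 6 * (N * p\<^sup>2 + 1) + 44 / 3 / p ^ 3"
  proof -
    have "K * p\<^sup>2 \<le> (N + 1) * p\<^sup>2" using K by (intro mult_right_mono) auto
    moreover have "p\<^sup>2 \<le> 1" using p p_le by (simp add: power_le_one)
    ultimately show ?thesis by (simp add: algebra_simps)
  qed
  also have "\<dots> \<le> 6 * (N * p\<^sup>2) + 21 / p ^ 3"
  proof -
    have "1 \<le> 1 / p ^ 3" using p p_le by (simp add: power_le_one)
    then show ?thesis by simp
  qed
  finally show ?thesis unfolding p2 p3 by simp
qed

lemma C2_on_subset: "C2_on S f f' f'' \<Longrightarrow> T \<subseteq> S \<Longrightarrow> C2_on T f f' f''"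
  unfolding C2_on_def
  by (meson has_field_derivative_subset continuous_on_subset subsetD)

text \<open>
  The mean value theorem, applied to \<open>f (t + 1) - f t\<close> and then to \<open>f'\<close>.
\<close>

lemma second_difference_mean_value:
  assumes C2: "C2_on {a..b} f f' f''" and x: "a \<le> x" "x + 2 \<le> b"
  obtains z where "z \<in> {a..b}" "2 * f (x + 1) - f x - f (x + 2) = - f'' z"
proof -
  have f: "(f has_real_derivative f' t) (at t within {a..b})"
    and f': "(f' has_real_derivative f'' t) (at t within {a..b})" if "t \<in> {a..b}" for t
    using C2 that by (auto simp: C2_on_def)
  have shift: "((\<lambda>t. f (t + 1)) has_real_derivative f' (t + 1)) (at t within {x..x + 1})"
    if "t \<in> {x..x + 1}" for t
  proof -
    have "(f has_real_derivative f' (t + 1)) (at (t + 1) within (\<lambda>t. t + 1) ` {x..x + 1})"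
      using that x by (intro has_field_derivative_subset[OF f]) auto
    moreover have "((\<lambda>t. t + 1) has_real_derivative 1) (at t within {x..x + 1})"
      by (auto intro!: derivative_eq_intros)
    ultimately have "(f \<circ> (\<lambda>t. t + 1) has_real_derivative f' (t + 1) * 1) (at t within {x..x + 1})"
      by (rule DERIV_image_chain)
    then show ?thesis by (simp add: o_def)
  qed
  have "\<exists>t\<in>{x<..<x + 1}. (f (x + 1 + 1) - f (x + 1)) - (f (x + 1) - f x) = (f' (t + 1) - f' t) * (x + 1 - x)"
  proof (rule mvt_simple)
    fix t assume t: "x \<le> t" "t \<le> x + 1"
    have "((\<lambda>t. f (t + 1) - f t) has_real_derivative f' (t + 1) - f' t) (at t within {x..x + 1})"
      using t x by (intro DERIV_diff shift has_field_derivative_subset[OF f]) auto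
    then show "((\<lambda>t. f (t + 1) - f t) has_derivative (\<lambda>u. (f' (t + 1) - f' t) * u)) (at t within {x..x + 1})"
      by (rule has_field_derivative_imp_has_derivative)
  qed simp
  then obtain t where t: "t \<in> {x<..<x + 1}"
    "(f (x + 1 + 1) - f (x + 1)) - (f (x + 1) - f x) = f' (t + 1) - f' t" by auto
  have "\<exists>z\<in>{t<..<t + 1}. f' (t + 1) - f' t = f'' z * (t + 1 - t)"
  proof (rule mvt_simple)
    fix z assume "t \<le> z" "z \<le> t + 1"
    then have "(f' has_real_derivative f'' z) (at z within {t..t + 1})"
      using t x by (intro has_field_derivative_subset[OF f']) auto
    then show "(f' has_derivative (\<lambda>u. f'' z * u)) (at z within {t..t + 1})"
      by (rule has_field_derivative_imp_has_derivative)
  qed simp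
  then obtain z where z: "z \<in> {t<..<t + 1}" "f' (t + 1) - f' t = f'' z" by auto
  show ?thesis
  proof (rule that)
    show "z \<in> {a..b}" using z t x by auto
    have "f (x + 1 + 1) = f (x + 2)" by (rule arg_cong[of _ _ f]) simp
    then show "2 * f (x + 1) - f x - f (x + 2) = - f'' z" using t(2) z(2) by linarith
  qed
qed

definition nats_in :: "real \<Rightarrow> real \<Rightarrow> nat set"
  where "nats_in a b = {n. a < real n \<and> real n \<le> b}"

lemma nats_in_eq:
  assumes "0 \<le> a"
  shows "nats_in a b = {nat \<lfloor>a\<rfloor> <..nat \<lfloor>b\<rfloor>}"
proof -
  have "a < real n \<longleftrightarrow> nat \<lfloor>a\<rfloor> < n" for n
    using assms floor_less_iff[of a "int n"] by (simp add: nat_less_iff)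
  moreover have "real n \<le> b \<longleftrightarrow> n \<le> nat \<lfloor>b\<rfloor>" if "0 < n" for n
    using that le_floor_iff[of "int n" b] by (cases "0 \<le> b") (auto simp: le_nat_iff)
  ultimately show ?thesis unfolding nats_in_def by (auto simp del: of_nat_0_less_iff)
qed

lemma finite_nats_in [simp]: "0 \<le> a \<Longrightarrow> finite (nats_in a b)"
  by (simp add: nats_in_eq)

lemma card_nats_in_le:
  assumes "0 \<le> a" "a \<le> b"
  shows "real (card (nats_in a b)) \<le> b - a + 1"
proof -
  have "nat \<lfloor>a\<rfloor> \<le> nat \<lfloor>b\<rfloor>" using assms by (intro nat_mono floor_mono)
  then show ?thesis using assms by (simp add: nats_in_eq of_nat_diff) linarith
qed

lemma sum_nats_in_split:
  assumes "0 \<le> a" "a \<le> c" "c \<le> b"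
  shows "sum h (nats_in a b) = sum h (nats_in a c) + sum h (nats_in c b)"
proof -
  have "nats_in a b = nats_in a c \<union> nats_in c b" "nats_in a c \<inter> nats_in c b = {}"
    using assms by (auto simp: nats_in_def)
  then show ?thesis using assms by (simp add: sum.union_disjoint)
qed

lemma abs_sawtooth_le: "\<bar>sawtooth x\<bar> \<le> 1/2"
  using frac_lt_1[of x] frac_ge_0[of x] unfolding sawtooth_def by linarith

lemma sawtooth_sum_trivial:
  assumes "0 \<le> a" "a \<le> b"
  shows "\<bar>\<Sum>n\<in>nats_in a b. sawtooth (f (real n))\<bar> \<le> (b - a) / 2 + 1/2"
proof -
  have "\<bar>\<Sum>n\<in>nats_in a b. sawtooth (f (real n))\<bar> \<le> (\<Sum>n\<in>nats_in a b. \<bar>sawtooth (f (real n))\<bar>)"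
    by (rule sum_abs)
  also have "\<dots> \<le> (\<Sum>n\<in>nats_in a b. 1/2)" by (intro sum_mono abs_sawtooth_le)
  also have "\<dots> \<le> (b - a) / 2 + 1/2" using card_nats_in_le[OF assms] by (simp add: field_simps)
  finally show ?thesis .
qed

lemma sawtooth_sum_dyadic_block:
  assumes ab: "0 \<le> a" "a \<le> b" and C2: "C2_on {a..b} f f' f''"
    and \<Lambda>: "0 < \<Lambda>" "\<Lambda> \<le> 1"
    and f'': "\<And>x. x \<in> {a..b} \<Longrightarrow> \<Lambda> \<le> - f'' x \<and> - f'' x \<le> 2 * \<Lambda>"
  shows "\<bar>\<Sum>n\<in>nats_in a b. sawtooth (f (real n))\<bar> \<le> 6 * (b - a) * \<Lambda> powr (1/3) + 21 / sqrt \<Lambda>"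
proof -
  define p where "p = Suc (nat \<lfloor>a\<rfloor>)"
  define K where "K = card (nats_in a b)"
  have set_eq: "nats_in a b = {p..<p + K}"
    unfolding K_def nats_in_eq[OF ab(1)] p_def by (auto simp: less_Suc_eq_le)
  have mem: "a < real (p + n)" "real (p + n) \<le> b" if "n < K" for n
  proof -
    have "p + n \<in> nats_in a b" using that set_eq by auto
    then show "a < real (p + n)" "real (p + n) \<le> b" by (auto simp: nats_in_def)
  qed
  have "\<Lambda> \<le> 2 * f (real (p + (n + 1))) - f (real (p + n)) - f (real (p + (n + 2)))
      \<and> 2 * f (real (p + (n + 1))) - f (real (p + n)) - f (real (p + (n + 2))) \<le> 2 * \<Lambda>"
    if n: "n + 2 < K" for n
  proof -
    have "a \<le> real (p + n)" "real (p + n) + 2 \<le> b"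
      using mem[of n] mem[of "n + 2"] n by auto
    from second_difference_mean_value[OF C2 this] obtain z where
      "z \<in> {a..b}" "2 * f (real (p + n) + 1) - f (real (p + n)) - f (real (p + n) + 2) = - f'' z" .
    moreover have "real (p + (n + 1)) = real (p + n) + 1" "real (p + (n + 2)) = real (p + n) + 2" by simp_all
    ultimately show ?thesis using f''[of z] by (simp only:)
  qed
  then have "\<bar>\<Sum>n<K. sawtooth (f (real (p + n)))\<bar> \<le> 6 * (b - a) * \<Lambda> powr (1/3) + 21 / sqrt \<Lambda>"
    using card_nats_in_le[OF ab] ab
    by (intro sawtooth_sum_second_differences \<Lambda>) (auto simp: K_def)
  also have "(\<Sum>n<K. sawtooth (f (real (p + n)))) = (\<Sum>n\<in>nats_in a b. sawtooth (f (real n)))"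
    unfolding set_eq by (intro sum.reindex_bij_witness[of _ "\<lambda>n. n - p" "\<lambda>n. p + n"]) auto
  finally show ?thesis .
qed

lemma continuous_on_cube_root_curvature:
  assumes "C2_on S f f' f''" "\<And>x. x \<in> S \<Longrightarrow> f'' x < 0"
  shows "continuous_on S (\<lambda>x. \<bar>f'' x\<bar> powr (1/3))"
  using assms unfolding C2_on_def by (intro continuous_intros) force+

lemma cube_root_curvature_integral_ge:
  assumes "a \<le> b" and C2: "C2_on {a..b} f f' f''"
    and "0 < \<Lambda>" and f'': "\<And>x. x \<in> {a..b} \<Longrightarrow> \<Lambda> \<le> - f'' x"
  shows "(b - a) * \<Lambda> powr (1/3) \<le> integral {a..b} (\<lambda>x. \<bar>f'' x\<bar> powr (1/3))"
proof -
  have neg: "f'' x < 0" if "x \<in> {a..b}" for x using f''[OF that] assms(3) by linarith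
  have "integral {a..b} (\<lambda>x. \<Lambda> powr (1/3)) \<le> integral {a..b} (\<lambda>x. \<bar>f'' x\<bar> powr (1/3))"
  proof (rule integral_le)
    show "(\<lambda>x. \<bar>f'' x\<bar> powr (1/3)) integrable_on {a..b}"
      using neg by (intro integrable_continuous_real continuous_on_cube_root_curvature[OF C2])
    show "\<Lambda> powr (1/3) \<le> \<bar>f'' x\<bar> powr (1/3)" if "x \<in> {a..b}" for x
      using f''[OF that] neg[OF that] assms(3) by (intro powr_mono2) auto
  qed auto
  then show ?thesis using assms(1) by simp
qed

text \<open>
  The number of terms is at most \<open>b - a + 1\<close>, so the trivial bound is half of this. It suffices when
  \<open>\<Lambda> > 1/1728\<close>, as then \<open>6 \<Lambda>\<^sup>1\<^sup>/\<^sup>3 > 1/2\<close>. It is also the source of the additive \<open>1/2\<close>.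
\<close>

lemma sawtooth_sum_unsplit:
  assumes ab: "0 \<le> a" "a \<le> b" and C2: "C2_on {a..b} f f' f''"
    and \<Lambda>: "0 < \<Lambda>" and f'': "\<And>x. x \<in> {a..b} \<Longrightarrow> \<Lambda> \<le> - f'' x"
    and cases: "1/1728 < \<Lambda> \<or> (\<forall>x\<in>{a..b}. - f'' x \<le> 2 * \<Lambda>)"
  shows "\<bar>\<Sum>n\<in>nats_in a b. sawtooth (f (real n))\<bar>
    \<le> 6 * integral {a..b} (\<lambda>x. \<bar>f'' x\<bar> powr (1/3)) + 21 / sqrt \<Lambda> + 1/2"
proof -
  let ?I = "integral {a..b} (\<lambda>x. \<bar>f'' x\<bar> powr (1/3))"
  have I: "(b - a) * \<Lambda> powr (1/3) \<le> ?I"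
    by (rule cube_root_curvature_integral_ge[OF ab(2) C2 \<Lambda> f''])
  have pos: "0 \<le> 21 / sqrt \<Lambda>" using \<Lambda> by simp
  show ?thesis
  proof (cases "1/1728 < \<Lambda>")
    case True
    have "1 / 12 = ((1 / 12) powr 3) powr (1/3 :: real)" by (subst powr_powr) simp
    also have "(1 / 12) powr 3 = (1/1728 :: real)" by (simp add: powr_numeral power3_eq_cube)
    also have "(1/1728) powr (1/3) \<le> \<Lambda> powr (1/3)" using True by (intro powr_mono2) auto
    finally have "(b - a) * (1 / 12) \<le> (b - a) * \<Lambda> powr (1/3)" using ab by (intro mult_left_mono) auto
    then show ?thesis using sawtooth_sum_trivial[OF ab, of f] I pos by argo
  next
    case False
    then have "\<bar>\<Sum>n\<in>nats_in a b. sawtooth (f (real n))\<bar> \<le> 6 * (b - a) * \<Lambda> powr (1/3) + 21 / sqrt \<Lambda>"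
      using cases f'' \<Lambda> by (intro sawtooth_sum_dyadic_block[OF ab C2]) auto
    then show ?thesis using I by linarith
  qed
qed

text \<open>
  Induction on the number of dyadic ranges that \<open>\<bar>f''\<bar>\<close> meets. Since \<open>f''\<close> is monotone, the part of
  \<open>[a, b]\<close> with \<open>\<bar>f''\<bar> \<le> 2 \<Lambda>\<close> is an interval at one end, and \<open>\<Lambda>\<close> may be doubled on the rest. A block adds
  \<open>21 \<Lambda>\<^sup>-\<^sup>1\<^sup>/\<^sup>2\<close>, and this is less than what is gained by replacing \<open>175 \<Lambda>\<^sup>-\<^sup>1\<^sup>/\<^sup>2\<close> by \<open>175 (2 \<Lambda>)\<^sup>-\<^sup>1\<^sup>/\<^sup>2\<close>. The
  trivial bound, and with it the term \<open>1/2\<close>, enters only once, where the doubling stops.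
\<close>

lemma van_der_corput_sawtooth:
  assumes "0 \<le> a" "a \<le> b" and "C2_on {a..b} f f' f''"
    and "0 < \<Lambda>"
    and "\<And>x. x \<in> {a..b} \<Longrightarrow> \<Lambda> \<le> - f'' x" "\<And>x. x \<in> {a..b} \<Longrightarrow> - f'' x \<le> 2 ^ k * \<Lambda>"
    and "mono_on {a..b} f'' \<or> antimono_on {a..b} f''"
  shows "\<bar>\<Sum>n\<in>nats_in a b. sawtooth (f (real n))\<bar>
    \<le> 6 * integral {a..b} (\<lambda>x. \<bar>f'' x\<bar> powr (1/3)) + 175 / sqrt \<Lambda> + 1/2"
  using assms
proof (induction k arbitrary: a b \<Lambda>)
  case 0
  have "\<forall>x\<in>{a..b}. - f'' x \<le> 2 * \<Lambda>"
    using 0 by force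
  then have "\<bar>\<Sum>n\<in>nats_in a b. sawtooth (f (real n))\<bar>
      \<le> 6 * integral {a..b} (\<lambda>x. \<bar>f'' x\<bar> powr (1/3)) + 21 / sqrt \<Lambda> + 1/2"
    using 0 by (intro sawtooth_sum_unsplit[of a b f f']) auto
  also have "\<dots> \<le> 6 * integral {a..b} (\<lambda>x. \<bar>f'' x\<bar> powr (1/3)) + 175 / sqrt \<Lambda> + 1/2"
    using \<open>0 < \<Lambda>\<close> by (simp add: divide_right_mono)
  finally show ?case .
next
  case (Suc k)
  note ab = Suc.prems(1,2) and C2 = Suc.prems(3) and \<Lambda> = Suc.prems(4)
    and lower = Suc.prems(5) and upper = Suc.prems(6)
  let ?r = "\<lambda>x. \<bar>f'' x\<bar> powr (1/3)"
  let ?S = "\<lambda>a b. \<Sum>n\<in>nats_in a b. sawtooth (f (real n))"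
  have upper2: "- f'' x \<le> 2 ^ k * (2 * \<Lambda>)" if "x \<in> {a..b}" for x
    using upper[OF that] by (simp add: mult_ac)
  have mono_sub: "mono_on {c..d} f'' \<or> antimono_on {c..d} f''" if "a \<le> c" "d \<le> b" for c d
    using Suc.prems(7) that by (auto intro: monotone_on_subset)
  have IH: "\<bar>?S c d\<bar> \<le> 6 * integral {c..d} ?r + 175 / sqrt (2 * \<Lambda>) + 1/2"
    if "a \<le> c" "c \<le> d" "d \<le> b" "\<And>x. x \<in> {c..d} \<Longrightarrow> 2 * \<Lambda> \<le> - f'' x" for c d
    using that ab \<Lambda> upper2 mono_sub[of c d] by (intro Suc.IH C2_on_subset[OF C2]) auto
  have block: "\<bar>?S c d\<bar> \<le> 6 * integral {c..d} ?r + 21 / sqrt \<Lambda>"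
    if "a \<le> c" "c \<le> d" "d \<le> b" "\<And>x. x \<in> {c..d} \<Longrightarrow> - f'' x \<le> 2 * \<Lambda>" "\<Lambda> \<le> 1" for c d
  proof -
    have C2': "C2_on {c..d} f f' f''" using that by (intro C2_on_subset[OF C2]) auto
    have "\<bar>?S c d\<bar> \<le> 6 * (d - c) * \<Lambda> powr (1/3) + 21 / sqrt \<Lambda>"
      using that ab \<Lambda> lower by (intro sawtooth_sum_dyadic_block[OF _ _ C2']) auto
    moreover have "(d - c) * \<Lambda> powr (1/3) \<le> integral {c..d} ?r"
      using that ab lower by (intro cube_root_curvature_integral_ge[OF _ C2' \<Lambda>]) auto
    ultimately show ?thesis by linarith
  qed
  have "?r integrable_on {a..b}"
    using lower \<Lambda> by (intro integrable_continuous_real continuous_on_cube_root_curvature[OF C2]) force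
  then have combine: "integral {a..c} ?r + integral {c..b} ?r = integral {a..b} ?r"
    if "c \<in> {a..b}" for c using that by (intro Henstock_Kurzweil_Integration.integral_combine) auto
  have split: "?S a b = ?S a c + ?S c b" if "c \<in> {a..b}" for c
    using that ab by (intro sum_nats_in_split) auto
  have constants: "21 / sqrt \<Lambda> + 175 / sqrt (2 * \<Lambda>) \<le> 175 / sqrt \<Lambda>"
  proof -
    have "175 / sqrt (2 * \<Lambda>) = 175 / sqrt 2 / sqrt \<Lambda>" by (simp add: real_sqrt_mult)
    also have "175 / sqrt 2 \<le> 175 / (5/4)" by (intro divide_left_mono real_le_rsqrt) (auto simp: power2_eq_square)
    finally have "175 / sqrt (2 * \<Lambda>) \<le> 140 / sqrt \<Lambda>" using \<Lambda> by (simp add: divide_right_mono)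
    moreover have "161 / sqrt \<Lambda> \<le> 175 / sqrt \<Lambda>" using \<Lambda> by (intro divide_right_mono) auto
    moreover have "21 / sqrt \<Lambda> + 140 / sqrt \<Lambda> = 161 / sqrt \<Lambda>" by (simp flip: add_divide_distrib)
    ultimately show ?thesis by linarith
  qed
  have cont: "continuous_on {c..d} f''" if "a \<le> c" "d \<le> b" for c d
    using C2 that unfolding C2_on_def by (auto intro: continuous_on_subset)
  consider (base) "1/1728 < \<Lambda> \<or> (\<forall>x\<in>{a..b}. - f'' x \<le> 2 * \<Lambda>)"
    | (steep) "\<forall>x\<in>{a..b}. 2 * \<Lambda> \<le> - f'' x"
    | (inc) x where "\<Lambda> \<le> 1" "antimono_on {a..b} f''" "- f'' a \<le> 2 * \<Lambda>" "x \<in> {a..b}" "2 * \<Lambda> \<le> - f'' x"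
    | (dec) x where "\<Lambda> \<le> 1" "mono_on {a..b} f''" "- f'' b \<le> 2 * \<Lambda>" "x \<in> {a..b}" "2 * \<Lambda> \<le> - f'' x"
  proof (cases "1/1728 < \<Lambda> \<or> (\<forall>x\<in>{a..b}. - f'' x \<le> 2 * \<Lambda>)")
    case False
    then obtain x where x: "x \<in> {a..b}" "2 * \<Lambda> \<le> - f'' x" by force
    have "\<Lambda> \<le> 1" using False by simp
    show ?thesis
      using Suc.prems(7)
    proof
      assume m: "mono_on {a..b} f''"
      show ?thesis
      proof (cases "- f'' b \<le> 2 * \<Lambda>")
        case True
        then show ?thesis using dec m x \<open>\<Lambda> \<le> 1\<close> by blast
      next
        case F: False
        have "2 * \<Lambda> \<le> - f'' y" if "y \<in> {a..b}" for y
          using monotone_onD[OF m that, of b] F that by auto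
        then show ?thesis using steep by blast
      qed
    next
      assume m: "antimono_on {a..b} f''"
      show ?thesis
      proof (cases "- f'' a \<le> 2 * \<Lambda>")
        case True
        then show ?thesis using inc m x \<open>\<Lambda> \<le> 1\<close> by blast
      next
        case F: False
        have "2 * \<Lambda> \<le> - f'' y" if "y \<in> {a..b}" for y
          using monotone_onD[OF m _ that, of a] F that by auto
        then show ?thesis using steep by blast
      qed
    qed
  qed (use base in blast)
  then show ?case
  proof cases
    case base
    then have "\<bar>?S a b\<bar> \<le> 6 * integral {a..b} ?r + 21 / sqrt \<Lambda> + 1/2"
      using lower by (intro sawtooth_sum_unsplit[OF ab C2 \<Lambda>]) auto
    also have "21 / sqrt \<Lambda> \<le> 175 / sqrt \<Lambda>" using \<Lambda> by (intro divide_right_mono) auto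
    finally show ?thesis by simp
  next
    case steep
    then have "\<bar>?S a b\<bar> \<le> 6 * integral {a..b} ?r + 175 / sqrt (2 * \<Lambda>) + 1/2"
      using ab by (intro IH) auto
    moreover have "0 \<le> 21 / sqrt \<Lambda>" using \<Lambda> by simp
    ultimately show ?thesis using constants by linarith
  next
    case inc
    have "\<exists>c\<ge>a. c \<le> x \<and> f'' c = - 2 * \<Lambda>"
      by (rule IVT2') (use inc cont in auto)
    then obtain c where c: "a \<le> c" "c \<le> b" "f'' c = - 2 * \<Lambda>" using inc by auto
    have "\<bar>?S a c\<bar> \<le> 6 * integral {a..c} ?r + 21 / sqrt \<Lambda>"
    proof (rule block)
      fix y assume "y \<in> {a..c}"
      then show "- f'' y \<le> 2 * \<Lambda>" using monotone_onD[OF inc(2), of y c] c by auto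
    qed (use c inc in auto)
    moreover have "\<bar>?S c b\<bar> \<le> 6 * integral {c..b} ?r + 175 / sqrt (2 * \<Lambda>) + 1/2"
    proof (rule IH)
      fix y assume "y \<in> {c..b}"
      then show "2 * \<Lambda> \<le> - f'' y" using monotone_onD[OF inc(2), of c y] c by auto
    qed (use c in auto)
    ultimately show ?thesis using constants split[of c] combine[of c] c by auto
  next
    case dec
    have "\<exists>c\<ge>x. c \<le> b \<and> f'' c = - 2 * \<Lambda>"
      by (rule IVT') (use dec cont in auto)
    then obtain c where "x \<le> c" and c: "c \<le> b" "f'' c = - 2 * \<Lambda>" by blast
    then have "a \<le> c" using dec by simp
    note c = this c
    have "\<bar>?S c b\<bar> \<le> 6 * integral {c..b} ?r + 21 / sqrt \<Lambda>"
    proof (rule block)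
      fix y assume "y \<in> {c..b}"
      then show "- f'' y \<le> 2 * \<Lambda>" using monotone_onD[OF dec(2), of c y] c by auto
    qed (use c dec in auto)
    moreover have "\<bar>?S a c\<bar> \<le> 6 * integral {a..c} ?r + 175 / sqrt (2 * \<Lambda>) + 1/2"
    proof (rule IH)
      fix y assume "y \<in> {a..c}"
      then show "2 * \<Lambda> \<le> - f'' y" using monotone_onD[OF dec(2), of y c] c by auto
    qed (use c in auto)
    ultimately show ?thesis using constants split[of c] combine[of c] c by auto
  qed
qed

section \<open>Lattice points in the columns under a curve\<close>

lemma deriv_nonneg_within_imp_le:
  fixes F :: "real \<Rightarrow> real"
  assumes "c \<le> y" and F: "\<And>t. t \<in> {c..y} \<Longrightarrow> (F has_real_derivative F' t) (at t within {c..y})"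
    and "\<And>t. t \<in> {c..y} \<Longrightarrow> 0 \<le> F' t"
  shows "F c \<le> F y"
proof (cases "c = y")
  case False
  then have "c < y" using assms by simp
  then have "\<exists>t\<in>{c<..<y}. F y - F c = F' t * (y - c)"
    by (rule mvt_simple) (use F has_field_derivative_imp_has_derivative in force)
  then obtain t where "t \<in> {c<..<y}" "F y - F c = F' t * (y - c)" by blast
  moreover from this have "0 \<le> F' t * (y - c)" using assms(3)[of t] by auto
  ultimately show ?thesis by simp
qed simp

text \<open>
  Let \<open>P\<close> be the primitive \<open>((t - c)\<^sup>2 - (t - c)) / 2\<close> of \<open>t - c - 1/2\<close>. The derivative of \<open>T\<close> with respect
  to \<open>y\<close> is \<open>- P f''\<close>, and \<open>- 1/8 \<le> P \<le> 0\<close> on \<open>[c, c + 1]\<close>. Hence \<open>T\<close> decreases from \<open>0\<close>, while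
  \<open>T - f' / 8\<close> increases.
\<close>

lemma trapezoid_error:
  fixes c y :: real
  assumes y: "c \<le> y" "y \<le> c + 1" and C2: "C2_on {c..y} f f' f''"
    and neg: "\<forall>x\<in>{c..y}. f'' x \<le> 0"
  defines "T \<equiv> (y - c - 1/2) * f y + f c / 2 - integral {c..y} f
    - ((y - c)\<^sup>2 - (y - c)) / 2 * f' y"
  shows "(f' y - f' c) / 8 \<le> T" "T \<le> 0"
proof -
  define P where "P t = ((t - c)\<^sup>2 - (t - c)) / 2" for t
  define U where "U t = (t - c - 1/2) * f t + f c / 2 - integral {c..t} f - P t * f' t" for t
  have f: "(f has_real_derivative f' t) (at t within {c..y})"
    and f': "(f' has_real_derivative f'' t) (at t within {c..y})" if "t \<in> {c..y}" for t
    using C2 that by (auto simp: C2_on_def)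
  have cont: "continuous_on {c..y} f" by (rule DERIV_continuous_on[OF f])
  have U_deriv: "(U has_real_derivative - (P t * f'' t)) (at t within {c..y})" if t: "t \<in> {c..y}" for t
  proof -
    have 1: "((\<lambda>t. (t - c - 1/2) * f t) has_real_derivative 1 * f t + f' t * (t - c - 1/2)) (at t within {c..y})"
      by (intro DERIV_mult f t) (auto intro!: derivative_eq_intros)
    have 2: "(P has_real_derivative (t - c - 1/2)) (at t within {c..y})"
      unfolding P_def by (auto intro!: derivative_eq_intros)
    have 3: "((\<lambda>t. P t * f' t) has_real_derivative (t - c - 1/2) * f' t + f'' t * P t) (at t within {c..y})"
      by (intro DERIV_mult f' t 2)
    have 4: "((\<lambda>t. f c / 2) has_real_derivative 0) (at t within {c..y})" by simp
    show ?thesis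
      unfolding U_def
      by (rule DERIV_cong[OF DERIV_diff[OF DERIV_diff[OF DERIV_add[OF 1 4] integral_has_real_derivative[OF cont t]] 3]])
        (simp add: algebra_simps)
  qed
  have P: "P t \<le> 0" "- (1/8) \<le> P t" if "t \<in> {c..y}" for t
  proof -
    have "0 \<le> (t - c) * (1 - (t - c))" using that y by (intro mult_nonneg_nonneg) auto
    then show "P t \<le> 0" by (simp add: P_def power2_eq_square algebra_simps)
    have "0 \<le> (t - c - 1/2)\<^sup>2" by simp
    then show "- (1/8) \<le> P t" by (simp add: P_def power2_eq_square algebra_simps)
  qed
  have U_c: "U c = 0" by (simp add: U_def P_def)
  have T: "T = U y" by (simp add: T_def U_def P_def)
  have "- U c \<le> - U y"
  proof (rule deriv_nonneg_within_imp_le[OF y(1)])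
    fix t assume t: "t \<in> {c..y}"
    show "((\<lambda>t. - U t) has_real_derivative P t * f'' t) (at t within {c..y})"
      using DERIV_minus[OF U_deriv[OF t]] by simp
    show "0 \<le> P t * f'' t" using P[OF t] bspec[OF neg t] by (simp add: mult_nonpos_nonpos)
  qed
  then show "T \<le> 0" using U_c T by simp
  have "U c - f' c / 8 \<le> U y - f' y / 8"
  proof (rule deriv_nonneg_within_imp_le[OF y(1)])
    fix t assume t: "t \<in> {c..y}"
    show "((\<lambda>t. U t - f' t / 8) has_real_derivative - (P t * f'' t) - f'' t / 8) (at t within {c..y})"
      by (intro DERIV_diff U_deriv t DERIV_cdivide f')
    have "0 \<le> (P t + 1/8) * (- f'' t)" using P[OF t] bspec[OF neg t] by (intro mult_nonneg_nonneg) auto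
    then show "0 \<le> - (P t * f'' t) - f'' t / 8" by (simp add: algebra_simps)
  qed
  then show "(f' y - f' c) / 8 \<le> T" using U_c T by simp
qed

lemma nats_in_0_eq: "0 \<le> b \<Longrightarrow> nats_in 0 b = {0<..nat \<lfloor>b\<rfloor>}"
  by (simp add: nats_in_eq)

lemma sum_eq_integral_trapezoid:
  fixes \<alpha> :: real
  assumes C2: "C2_on {0..\<alpha>} f f' f''" and neg: "\<forall>x\<in>{0..\<alpha>}. f'' x \<le> 0"
    and m: "real m \<le> \<alpha>"
  defines "E \<equiv> (\<Sum>n\<in>{0<..m}. f (real n)) - integral {0..real m} f + f 0 / 2 - f (real m) / 2"
  shows "(f' (real m) - f' 0) / 8 \<le> E \<and> E \<le> 0"
  using m unfolding E_def
proof (induction m)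
  case (Suc m)
  let ?c = "real m" and ?y = "real (Suc m)"
  have C2': "C2_on {?c..?y} f f' f''" using Suc.prems by (intro C2_on_subset[OF C2]) auto
  have T: "(f' ?y - f' ?c) / 8 \<le> f ?y / 2 + f ?c / 2 - integral {?c..?y} f"
    "f ?y / 2 + f ?c / 2 - integral {?c..?y} f \<le> 0"
    using trapezoid_error[OF _ _ C2'] neg Suc.prems by (auto simp: power2_eq_square)
  have "f integrable_on {0..?y}"
  proof (rule integrable_continuous_real)
    show "continuous_on {0..?y} f"
      using C2 Suc.prems unfolding C2_on_def
      by (intro continuous_on_subset[OF DERIV_continuous_on[of "{0..\<alpha>}" f f']]) auto
  qed
  then have "integral {0..?c} f + integral {?c..?y} f = integral {0..?y} f"
    by (intro Henstock_Kurzweil_Integration.integral_combine) auto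
  moreover have "(\<Sum>n\<in>{0<..Suc m}. f (real n)) = (\<Sum>n\<in>{0<..m}. f (real n)) + f ?y"
  proof -
    have "{0<..Suc m} = insert (Suc m) {0<..m}" by auto
    then show ?thesis by simp
  qed
  moreover have "real m \<le> \<alpha>" using Suc.prems by simp
  ultimately show ?case using Suc.IH T by argo
qed simp

text \<open>
  The trapezoid errors of the unit intervals telescope to at most \<open>(f' 0 - f' \<alpha>) / 8\<close> in absolute value;
  the last, incomplete interval also produces \<open>P f' \<alpha>\<close> with \<open>P\<close> the primitive of the sawtooth at \<open>\<alpha>\<close>.
  These two errors have opposite signs, and each is at most \<open>\<bar>f' \<alpha>\<bar> / 8\<close>.
\<close>

lemma sum_eq_integral:
  assumes \<alpha>: "0 \<le> \<alpha>" and C2: "C2_on {0..\<alpha>} f f' f''"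
    and neg: "\<forall>x\<in>{0..\<alpha>}. f'' x \<le> 0" and f': "f' 0 \<le> 0" "f' \<alpha> \<le> 0"
  shows "\<bar>(\<Sum>n\<in>nats_in 0 \<alpha>. f (real n)) - (integral {0..\<alpha>} f - sawtooth \<alpha> * f \<alpha> - f 0 / 2)\<bar>
    \<le> \<bar>f' \<alpha>\<bar> / 8"
proof -
  define m where "m = nat \<lfloor>\<alpha>\<rfloor>"
  have m: "real m \<le> \<alpha>" "\<alpha> \<le> real m + 1" and frac: "\<alpha> - real m = frac \<alpha>"
    using \<alpha> by (auto simp: m_def frac_def)
  have C2': "C2_on {real m..\<alpha>} f f' f''" by (intro C2_on_subset[OF C2]) auto
  define P where "P = sawtooth_integral \<alpha>"
  have P: "((\<alpha> - real m)\<^sup>2 - (\<alpha> - real m)) / 2 = P" by (simp add: P_def sawtooth_integral_def frac)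
  have neg': "\<forall>x\<in>{real m..\<alpha>}. f'' x \<le> 0" using neg by auto
  note T = trapezoid_error[OF m C2' neg', unfolded P, unfolded frac, folded sawtooth_def]
  have "f integrable_on {0..\<alpha>}"
    using C2 unfolding C2_on_def
    by (intro integrable_continuous_real DERIV_continuous_on[of "{0..\<alpha>}" f f']) auto
  then have "integral {0..real m} f + integral {real m..\<alpha>} f = integral {0..\<alpha>} f"
    using m by (intro Henstock_Kurzweil_Integration.integral_combine) auto
  moreover note sum_eq_integral_trapezoid[OF C2 neg m(1)]
  moreover have "0 \<le> P * f' \<alpha>" "P * f' \<alpha> \<le> \<bar>f' \<alpha>\<bar> / 8"
  proof -
    have "0 \<le> frac \<alpha> * (1 - frac \<alpha>)" using frac_lt_1[of \<alpha>] by (intro mult_nonneg_nonneg) auto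
    then have "P \<le> 0" by (simp add: P_def sawtooth_integral_def power2_eq_square algebra_simps)
    then show "0 \<le> P * f' \<alpha>" using f' by (simp add: mult_nonpos_nonpos)
    have "0 \<le> (frac \<alpha> - 1/2)\<^sup>2" by simp
    then have "- (1/8) \<le> P" by (simp add: P_def sawtooth_integral_def power2_eq_square algebra_simps)
    then have "0 \<le> (P + 1/8) * (- f' \<alpha>)" using f' by (intro mult_nonneg_nonneg) auto
    then show "P * f' \<alpha> \<le> \<bar>f' \<alpha>\<bar> / 8" using f' by (simp add: algebra_simps)
  qed
  ultimately show ?thesis using T f' unfolding nats_in_0_eq[OF \<alpha>] m_def[symmetric] by argo
qed

text \<open>
  Here \<open>\<lfloor>t\<rfloor> = t - 1/2 - \<psi>(t)\<close> for \<open>t = f(n)\<close>, and \<open>\<Lambda>\<close> is the minimum of \<open>\<bar>f''\<bar>\<close>, whose inverse square root is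
  the supremum in the bound.
\<close>

lemma column_count:
  assumes \<alpha>: "0 < \<alpha>" and C2: "C2_on {0..\<alpha>} f f' f''"
    and f'_neg: "\<forall>x\<in>{0<..\<alpha>}. f' x < 0" and f''_neg: "\<forall>x\<in>{0..\<alpha>}. f'' x < 0"
    and mono: "mono_on {0..\<alpha>} f'' \<or> antimono_on {0..\<alpha>} f''"
  shows "\<bar>(\<Sum>n\<in>nats_in 0 \<alpha>. real_of_int \<lfloor>f (real n)\<rfloor>)
      - (integral {0..\<alpha>} f - sawtooth \<alpha> * f \<alpha> - f 0 / 2 - real_of_int \<lfloor>\<alpha>\<rfloor> / 2)\<bar>
    \<le> 6 * integral {0..\<alpha>} (\<lambda>x. \<bar>f'' x\<bar> powr (1/3))
      + 175 * (SUP x\<in>{0..\<alpha>}. 1 / \<bar>f'' x\<bar> powr (1/2)) + 1/4 * \<bar>f' \<alpha>\<bar> + 1"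
proof -
  have cont: "continuous_on {0..\<alpha>} f''" and cont': "continuous_on {0..\<alpha>} f'"
    using C2 unfolding C2_on_def by (auto intro: DERIV_continuous_on)
  \<comment> \<open>at \<open>0\<close> the derivative may vanish, and its sign comes from continuity\<close>
  have "f' 0 \<le> 0"
  proof (rule continuous_le_on_closure[where f = f' and S = "{0<..<\<alpha>}"])
    show "continuous_on (closure {0<..<\<alpha>}) f'" "0 \<in> closure {0<..<\<alpha>}"
      using cont' \<alpha> by (auto simp: closure_greaterThanLessThan)
    show "f' x \<le> 0" if "x \<in> {0<..<\<alpha>}" for x
      using bspec[OF f'_neg, of x] that by simp
  qed
  moreover have "f' \<alpha> \<le> 0" using bspec[OF f'_neg, of \<alpha>] \<alpha> by simp
  ultimately have integral: "\<bar>(\<Sum>n\<in>nats_in 0 \<alpha>. f (real n)) - (integral {0..\<alpha>} f - sawtooth \<alpha> * f \<alpha> - f 0 / 2)\<bar>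
    \<le> \<bar>f' \<alpha>\<bar> / 8"
    using \<alpha> f''_neg by (intro sum_eq_integral[OF _ C2]) (auto simp: less_imp_le)
  obtain x0 where x0: "x0 \<in> {0..\<alpha>}" "\<And>x. x \<in> {0..\<alpha>} \<Longrightarrow> f'' x \<le> f'' x0"
    using continuous_attains_sup[OF _ _ cont] \<alpha> by auto
  obtain x1 where x1: "x1 \<in> {0..\<alpha>}" "\<And>x. x \<in> {0..\<alpha>} \<Longrightarrow> f'' x1 \<le> f'' x"
    using continuous_attains_inf[OF _ _ cont] \<alpha> by auto
  define \<Lambda> where "\<Lambda> = - f'' x0"
  have \<Lambda>: "0 < \<Lambda>" using f''_neg x0 by (auto simp: \<Lambda>_def)
  obtain k where "- f'' x1 / \<Lambda> < 2 ^ k" using real_arch_pow[of 2 "- f'' x1 / \<Lambda>"] by auto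
  then have "- f'' x1 < 2 ^ k * \<Lambda>" by (subst (asm) pos_divide_less_eq[OF \<Lambda>])
  then have k: "- f'' x1 \<le> 2 ^ k * \<Lambda>" by simp
  have "- f'' x \<le> 2 ^ k * \<Lambda>" if "x \<in> {0..\<alpha>}" for x
    using k x1(2)[OF that] by linarith
  then have "\<bar>\<Sum>n\<in>nats_in 0 \<alpha>. sawtooth (f (real n))\<bar>
    \<le> 6 * integral {0..\<alpha>} (\<lambda>x. \<bar>f'' x\<bar> powr (1/3)) + 175 / sqrt \<Lambda> + 1/2"
    using \<alpha> \<Lambda> x0(2) mono by (intro van_der_corput_sawtooth[OF _ _ C2]) (auto simp: \<Lambda>_def)
  moreover have "1 / sqrt \<Lambda> \<le> (SUP x\<in>{0..\<alpha>}. 1 / \<bar>f'' x\<bar> powr (1/2))"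
  proof -
    have "1 / \<bar>f'' x\<bar> powr (1/2) \<le> 1 / sqrt \<Lambda>" if "x \<in> {0..\<alpha>}" for x
    proof -
      have "sqrt \<Lambda> \<le> sqrt \<bar>f'' x\<bar>" using x0(2)[OF that] by (intro real_sqrt_le_mono) (auto simp: \<Lambda>_def)
      then show ?thesis using \<Lambda> by (auto simp: powr_half_sqrt intro!: frac_le)
    qed
    then have "bdd_above ((\<lambda>x. 1 / \<bar>f'' x\<bar> powr (1/2)) ` {0..\<alpha>})" by (intro bdd_aboveI2)
    then have "1 / \<bar>f'' x0\<bar> powr (1/2) \<le> (SUP x\<in>{0..\<alpha>}. 1 / \<bar>f'' x\<bar> powr (1/2))"
      by (rule cSUP_upper[OF x0(1)])
    moreover have "\<bar>f'' x0\<bar> = \<Lambda>" using \<Lambda> by (simp add: \<Lambda>_def)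
    ultimately show ?thesis using \<Lambda> by (simp add: powr_half_sqrt)
  qed
  moreover have "(\<Sum>n\<in>nats_in 0 \<alpha>. real_of_int \<lfloor>f (real n)\<rfloor>)
      = (\<Sum>n\<in>nats_in 0 \<alpha>. f (real n)) - real_of_int \<lfloor>\<alpha>\<rfloor> / 2 - (\<Sum>n\<in>nats_in 0 \<alpha>. sawtooth (f (real n)))"
  proof -
    have "(\<Sum>n\<in>nats_in 0 \<alpha>. real_of_int \<lfloor>f (real n)\<rfloor>)
        = (\<Sum>n\<in>nats_in 0 \<alpha>. f (real n) - 1/2 - sawtooth (f (real n)))"
      by (intro sum.cong refl) (simp add: sawtooth_def frac_def)
    then show ?thesis using \<alpha> by (simp add: sum_subtractf nats_in_0_eq)
  qed
  ultimately show ?thesis using integral by argo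
qed

section \<open>Cutting the region under the curve into two parts\<close>

lemma closed_under_graph:
  fixes f :: "real \<Rightarrow> real"
  assumes "continuous_on {0..a} f"
  shows "closed {(x, y). x \<in> {0..a} \<and> 0 \<le> y \<and> y \<le> f x}"
proof -
  have "continuous_on ({0..a} \<times> {0..}) (\<lambda>p. f (fst p))"
    by (intro continuous_on_compose2[OF assms] continuous_intros) auto
  then have "closed {p \<in> {0..a} \<times> {0..}. snd p \<le> f (fst p)}"
    by (intro continuous_on_closed_Collect_le continuous_intros closed_Times) auto
  also have "{p \<in> {0..a} \<times> {0..}. snd p \<le> f (fst p)} = {(x, y). x \<in> {0..a} \<and> 0 \<le> y \<and> y \<le> f x}"
    by auto
  finally show ?thesis .
qed

text \<open>
  The integral of the lengths of the vertical sections of the region under \<open>f\<close>, as it appears in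
  Tonelli's theorem. It serves for the region under \<open>f\<close> and, with the coordinates exchanged, for \<open>g\<close>.
\<close>

lemma nn_integral_sections:
  fixes f :: "real \<Rightarrow> real"
  assumes "continuous_on {0..a} f" and nonneg: "\<And>x. x \<in> {0..a} \<Longrightarrow> 0 \<le> f x"
  shows "(\<integral>\<^sup>+x. emeasure lborel {y. x \<in> {0..a} \<and> 0 \<le> y \<and> y \<le> f x} \<partial>lborel)
    = ennreal (integral {0..a} f)"
proof -
  have "emeasure lborel {y. x \<in> {0..a} \<and> 0 \<le> y \<and> y \<le> f x} = ennreal (f x) * indicator {0..a} x" for x
  proof (cases "x \<in> {0..a}")
    case True
    then have "{y. x \<in> {0..a} \<and> 0 \<le> y \<and> y \<le> f x} = {0..f x}" by auto
    then show ?thesis using True nonneg[OF True] by simp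
  next
    case False
    then have "{y. x \<in> {0..a} \<and> 0 \<le> y \<and> y \<le> f x} = {}" by auto
    then show ?thesis using False by (simp only:) simp
  qed
  moreover have "(f has_integral integral {0..a} f) {0..a}"
    using assms(1) by (intro integrable_integral integrable_continuous_real)
  then have "(\<integral>\<^sup>+x\<in>{0..a}. ennreal (f x) \<partial>lborel) = ennreal (integral {0..a} f)"
    by (rule nn_integral_has_integral_lebesgue'[rotated]) (rule nonneg)
  ultimately show ?thesis by simp
qed

lemma emeasure_under_graph:
  fixes f :: "real \<Rightarrow> real"
  assumes f: "continuous_on {0..a} f" and nonneg: "\<And>x. x \<in> {0..a} \<Longrightarrow> 0 \<le> f x"
  shows "emeasure lborel {(x, y). x \<in> {0..a} \<and> 0 \<le> y \<and> y \<le> f x} = ennreal (integral {0..a} f)"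
proof -
  let ?A = "{(x, y). x \<in> {0..a} \<and> 0 \<le> y \<and> y \<le> f x}"
  have "?A \<in> sets (lborel \<Otimes>\<^sub>M lborel)"
    unfolding lborel_prod using borel_closed[OF closed_under_graph[OF f]] by simp
  then have "emeasure (lborel \<Otimes>\<^sub>M lborel) ?A = (\<integral>\<^sup>+x. emeasure lborel (Pair x -` ?A) \<partial>lborel)"
    by (rule lborel.emeasure_pair_measure_alt)
  also have "\<dots> = ennreal (integral {0..a} f)"
    using nn_integral_sections[OF f nonneg] by (simp add: vimage_def)
  finally show ?thesis by (simp add: lborel_prod)
qed

lemma closed_swapped_under_graph:
  fixes g :: "real \<Rightarrow> real"
  assumes "continuous_on {0..b} g"
  shows "closed {(x, y). y \<in> {0..b} \<and> 0 \<le> x \<and> x \<le> g y}"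
proof -
  have "closed (prod.swap -` {(y, x). y \<in> {0..b} \<and> 0 \<le> x \<and> x \<le> g y})"
    by (intro closed_vimage closed_under_graph assms continuous_on_swap)
  also have "prod.swap -` {(y, x). y \<in> {0..b} \<and> 0 \<le> x \<and> x \<le> g y} = {(x, y). y \<in> {0..b} \<and> 0 \<le> x \<and> x \<le> g y}"
    by auto
  finally show ?thesis .
qed

lemma emeasure_swapped_under_graph:
  fixes g :: "real \<Rightarrow> real"
  assumes g: "continuous_on {0..b} g" and nonneg: "\<And>y. y \<in> {0..b} \<Longrightarrow> 0 \<le> g y"
  shows "emeasure lborel {(x, y). y \<in> {0..b} \<and> 0 \<le> x \<and> x \<le> g y} = ennreal (integral {0..b} g)"
proof -
  let ?A = "{(x, y). y \<in> {0..b} \<and> 0 \<le> x \<and> x \<le> g y}"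
  have "?A \<in> sets (lborel \<Otimes>\<^sub>M lborel)"
    unfolding lborel_prod using borel_closed[OF closed_swapped_under_graph[OF g]] by simp
  then have "emeasure (lborel \<Otimes>\<^sub>M lborel) ?A = (\<integral>\<^sup>+y. emeasure lborel ((\<lambda>x. (x, y)) -` ?A) \<partial>lborel)"
    by (rule lborel_pair.emeasure_pair_measure_alt2)
  also have "\<dots> = ennreal (integral {0..b} g)"
    using nn_integral_sections[OF g nonneg] by (simp add: vimage_def)
  finally show ?thesis by (simp add: lborel_prod)
qed

text \<open>
  The graph of \<open>f\<close> as a curve with intercepts \<open>L\<close> and \<open>M\<close>, its inverse \<open>g\<close>, and the point \<open>(\<alpha>, \<beta>)\<close> at which
  the curve is cut.
\<close>

locale inverse_curves =
  fixes f g :: "real \<Rightarrow> real" and L M \<alpha> \<beta> :: real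
  assumes anti: "strict_antimono_on {0..L} f"
    and f_0: "f 0 = M" and f_L: "f L = 0"
    and g_inv: "\<And>y. y \<in> {0..M} \<Longrightarrow> g y \<in> {0..L} \<and> f (g y) = y"
    and f_inv: "\<And>x. x \<in> {0..L} \<Longrightarrow> g (f x) = x"
    and \<alpha>: "0 < \<alpha>" "\<alpha> \<le> L" and \<beta>: "0 < \<beta>" and f_\<alpha>: "f \<alpha> = \<beta>"
begin

lemma f_le_iff: "x \<in> {0..L} \<Longrightarrow> y \<in> {0..L} \<Longrightarrow> f x \<le> f y \<longleftrightarrow> y \<le> x"
  using monotone_onD[OF anti, of x y] monotone_onD[OF anti, of y x] by (cases x y rule: linorder_cases) auto

lemma f_mem: "x \<in> {0..L} \<Longrightarrow> f x \<in> {0..M}"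
  using f_le_iff[of x 0] f_le_iff[of L x] \<alpha> f_0 f_L by auto

lemma \<beta>_le: "\<beta> \<le> M"
  using f_mem[of \<alpha>] \<alpha> f_\<alpha> by auto

lemma g_\<beta>: "g \<beta> = \<alpha>"
  using f_inv[of \<alpha>] \<alpha> f_\<alpha> by auto

lemma le_f_iff_le_g: "x \<in> {0..L} \<Longrightarrow> y \<in> {0..M} \<Longrightarrow> y \<le> f x \<longleftrightarrow> x \<le> g y"
  using f_le_iff[of "g y" x] g_inv[of y] by auto

lemma g_0: "g 0 = L"
  using f_inv[of L] f_L \<alpha> by auto

text \<open>
  This splits the region under the curve into the columns above \<open>[0, \<alpha>]\<close> and the rows beside \<open>[0, \<beta>]\<close>:
  right of \<open>\<alpha>\<close> the curve is below \<open>\<beta>\<close>. The two parts overlap in a rectangle (\<open>rectangle_under_curve\<close>).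
\<close>

lemma under_curve_iff:
  assumes "0 \<le> x" "0 \<le> y"
  shows "x \<le> L \<and> y \<le> f x \<longleftrightarrow> (x \<le> \<alpha> \<and> y \<le> f x) \<or> (y \<le> \<beta> \<and> x \<le> g y)"
proof -
  have "y \<le> \<beta> \<and> x \<le> g y" if "x \<le> L" "y \<le> f x" "\<not> x \<le> \<alpha>"
    using that assms f_le_iff[of x \<alpha>] le_f_iff_le_g[of x y] f_mem[of x] \<alpha> f_\<alpha> by auto
  moreover have "x \<le> L \<and> y \<le> f x" if "y \<le> \<beta>" "x \<le> g y"
    using that assms g_inv[of y] le_f_iff_le_g[of x y] \<beta>_le by auto
  ultimately show ?thesis using \<alpha> by auto
qed

lemma rectangle_under_curve:
  assumes "0 \<le> x" "x \<le> \<alpha>" "0 \<le> y" "y \<le> \<beta>"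
  shows "y \<le> f x" "x \<le> g y"
  using assms f_le_iff[of \<alpha> x] le_f_iff_le_g[of x y] \<alpha> \<beta>_le f_\<alpha> by auto

lemma curve_area_eq:
  assumes f: "continuous_on {0..\<alpha>} f" and g: "continuous_on {0..\<beta>} g"
  shows "curve_area L f = integral {0..\<alpha>} f + integral {0..\<beta>} g - \<alpha> * \<beta>"
proof -
  let ?A = "{(x, y). x \<in> {0..\<alpha>} \<and> 0 \<le> y \<and> y \<le> f x}"
  let ?B = "{(x, y). y \<in> {0..\<beta>} \<and> 0 \<le> x \<and> x \<le> g y}"
  have f_nonneg: "0 \<le> f x" if "x \<in> {0..\<alpha>}" for x using that f_mem[of x] \<alpha> by auto
  have g_nonneg: "0 \<le> g y" if "y \<in> {0..\<beta>}" for y using that g_inv[of y] \<beta>_le by auto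
  have int_nonneg: "0 \<le> integral {0..\<alpha>} f" "0 \<le> integral {0..\<beta>} g"
    using f_nonneg g_nonneg by (auto intro!: integral_nonneg integrable_continuous_real f g)
  note eA = emeasure_under_graph[OF f f_nonneg] and eB = emeasure_swapped_under_graph[OF g g_nonneg]
  have fmA: "?A \<in> fmeasurable lborel"
    using borel_closed[OF closed_under_graph[OF f]] eA by (intro fmeasurableI) auto
  have fmB: "?B \<in> fmeasurable lborel"
    using borel_closed[OF closed_swapped_under_graph[OF g]] eB by (intro fmeasurableI) auto
  have union: "{(x, y). 0 \<le> x \<and> x \<le> L \<and> 0 \<le> y \<and> y \<le> f x} = ?A \<union> ?B"
    using under_curve_iff by auto
  have inter: "?A \<inter> ?B = cbox (0, 0) (\<alpha>, \<beta>)"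
    by (auto simp: cbox_Pair_eq intro: rectangle_under_curve)
  have "measure lborel (?A \<inter> ?B) = \<alpha> * \<beta>"
    unfolding inter using \<alpha> \<beta> by (subst measure_lborel_cbox_eq) (simp add: Basis_prod_def)
  moreover have "measure lborel (?A \<union> ?B) = measure lborel ?A + measure lborel ?B - measure lborel (?A \<inter> ?B)"
    by (rule measure_Un3[OF fmA fmB])
  ultimately show ?thesis
    using eA eB int_nonneg unfolding curve_area_def union by (simp add: measure_def)
qed

lemma lattice_count_eq:
  "real (lattice_count L f 1 1) = (\<Sum>n\<in>nats_in 0 \<alpha>. real_of_int \<lfloor>f (real n)\<rfloor>)
    + (\<Sum>n\<in>nats_in 0 \<beta>. real_of_int \<lfloor>g (real n)\<rfloor>) - real_of_int \<lfloor>\<alpha>\<rfloor> * real_of_int \<lfloor>\<beta>\<rfloor>"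
proof -
  define A where "A = Sigma (nats_in 0 \<alpha>) (\<lambda>j. nats_in 0 (f (real j)))"
  define B where "B = Sigma (nats_in 0 \<beta>) (\<lambda>k. nats_in 0 (g (real k)))"
  have card: "real (card (Sigma (nats_in 0 a) (\<lambda>n. nats_in 0 (h (real n)))))
      = (\<Sum>n\<in>nats_in 0 a. real_of_int \<lfloor>h (real n)\<rfloor>)"
    if "\<And>n. n \<in> nats_in 0 a \<Longrightarrow> 0 \<le> h (real n)" for a h
    using that by (simp add: card_SigmaI nats_in_0_eq)
  have cA: "real (card A) = (\<Sum>n\<in>nats_in 0 \<alpha>. real_of_int \<lfloor>f (real n)\<rfloor>)"
    unfolding A_def using f_mem \<alpha> by (intro card) (auto simp: nats_in_def)
  have cB: "real (card B) = (\<Sum>n\<in>nats_in 0 \<beta>. real_of_int \<lfloor>g (real n)\<rfloor>)"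
    unfolding B_def using g_inv \<beta>_le by (intro card) (auto simp: nats_in_def)
  have cB': "card (prod.swap ` B) = card B" by (intro card_image) (auto simp: inj_on_def)
  have fin: "finite A" "finite (prod.swap ` B)" by (auto simp: A_def B_def)
  have union: "{(j, k). 0 < j \<and> 0 < k \<and> real j * 1 / 1 \<le> L \<and> real k \<le> 1 * 1 * f (real j * 1 / 1)}
      = A \<union> prod.swap ` B"
    using under_curve_iff[of "real _" "real _"] by (auto simp: A_def B_def nats_in_def image_iff)
  have inter: "A \<inter> prod.swap ` B = nats_in 0 \<alpha> \<times> nats_in 0 \<beta>"
    using rectangle_under_curve[of "real j" "real k" for j k]
    by (auto simp: A_def B_def nats_in_def image_iff)
  have "real (card A) + real (card (prod.swap ` B))
      = real (card (A \<union> prod.swap ` B)) + real (card (A \<inter> prod.swap ` B))"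
    unfolding of_nat_add[symmetric] by (rule arg_cong[OF card_Un_Int[OF fin]])
  moreover have "real (card (nats_in 0 \<alpha> \<times> nats_in 0 \<beta>)) = real_of_int \<lfloor>\<alpha>\<rfloor> * real_of_int \<lfloor>\<beta>\<rfloor>"
    using \<alpha> \<beta> by (simp add: card_cartesian_product nats_in_0_eq)
  ultimately show ?thesis
    unfolding lattice_count_def union inter cB' cA cB by linarith
qed

text \<open>
  With \<open>a = \<psi>(\<alpha>)\<close> and \<open>b = \<psi>(\<beta>)\<close>, hence \<open>\<lfloor>\<alpha>\<rfloor> = \<alpha> - a - 1/2\<close> and \<open>\<lfloor>\<beta>\<rfloor> = \<beta> - b - 1/2\<close>, everything but the
  errors \<open>X\<close> and \<open>Y\<close> of the column and row counts cancels up to \<open>1/4 - a b\<close>, of absolute value at most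
  \<open>1/2\<close>.
\<close>

lemma lattice_count_asymptotics:
  assumes f: "C2_on {0..\<alpha>} f f' f''"
    and "\<forall>x\<in>{0<..\<alpha>}. f' x < 0" and "\<forall>x\<in>{0..\<alpha>}. f'' x < 0"
    and "mono_on {0..\<alpha>} f'' \<or> antimono_on {0..\<alpha>} f''"
    and g: "C2_on {0..\<beta>} g g' g''"
    and "\<forall>y\<in>{0<..\<beta>}. g' y < 0" and "\<forall>y\<in>{0..\<beta>}. g'' y < 0"
    and "mono_on {0..\<beta>} g'' \<or> antimono_on {0..\<beta>} g''"
  shows "\<bar>real (lattice_count L f 1 1) - curve_area L f + (L + M) / 2\<bar>
      \<le> 6 * (integral {0..\<alpha>} (\<lambda>x. \<bar>f'' x\<bar> powr (1/3))
              + integral {0..\<beta>} (\<lambda>y. \<bar>g'' y\<bar> powr (1/3)))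
        + 175 * ((SUP x\<in>{0..\<alpha>}. 1 / \<bar>f'' x\<bar> powr (1/2))
              + (SUP y\<in>{0..\<beta>}. 1 / \<bar>g'' y\<bar> powr (1/2)))
        + 1 / 4 * (\<bar>f' \<alpha>\<bar> + \<bar>g' \<beta>\<bar>) + 3"
proof -
  define a b where "a = sawtooth \<alpha>" and "b = sawtooth \<beta>"
  have fl: "real_of_int \<lfloor>\<alpha>\<rfloor> = \<alpha> - a - 1/2" "real_of_int \<lfloor>\<beta>\<rfloor> = \<beta> - b - 1/2"
    by (simp_all add: a_def b_def sawtooth_def frac_def)
  have area: "curve_area L f = integral {0..\<alpha>} f + integral {0..\<beta>} g - \<alpha> * \<beta>"
    using f g unfolding C2_on_def by (intro curve_area_eq DERIV_continuous_on[of _ f f'] DERIV_continuous_on[of _ g g']) auto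
  have "\<bar>a * b\<bar> \<le> 1/2 * (1/2)"
    unfolding abs_mult a_def b_def by (intro mult_mono abs_sawtooth_le) auto
  then have ab: "\<bar>1/4 - a * b\<bar> \<le> 1/2" by linarith
  define X where "X = (\<Sum>n\<in>nats_in 0 \<alpha>. real_of_int \<lfloor>f (real n)\<rfloor>)
      - (integral {0..\<alpha>} f - a * \<beta> - M / 2 - real_of_int \<lfloor>\<alpha>\<rfloor> / 2)"
  define Y where "Y = (\<Sum>n\<in>nats_in 0 \<beta>. real_of_int \<lfloor>g (real n)\<rfloor>)
      - (integral {0..\<beta>} g - b * \<alpha> - L / 2 - real_of_int \<lfloor>\<beta>\<rfloor> / 2)"
  have "real (lattice_count L f 1 1) - curve_area L f + (L + M) / 2 = X + Y + (1/4 - a * b)"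
    unfolding lattice_count_eq area X_def Y_def fl by (simp add: field_simps)
  moreover have "\<bar>X\<bar> \<le> 6 * integral {0..\<alpha>} (\<lambda>x. \<bar>f'' x\<bar> powr (1/3))
      + 175 * (SUP x\<in>{0..\<alpha>}. 1 / \<bar>f'' x\<bar> powr (1/2)) + 1/4 * \<bar>f' \<alpha>\<bar> + 1"
    using column_count[OF \<alpha>(1) assms(1-4)] unfolding X_def a_def f_0 f_\<alpha> .
  moreover have "\<bar>Y\<bar> \<le> 6 * integral {0..\<beta>} (\<lambda>y. \<bar>g'' y\<bar> powr (1/3))
      + 175 * (SUP y\<in>{0..\<beta>}. 1 / \<bar>g'' y\<bar> powr (1/2)) + 1/4 * \<bar>g' \<beta>\<bar> + 1"
    using column_count[OF \<beta> assms(5-8)] unfolding Y_def b_def g_0 g_\<beta> .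
  ultimately show ?thesis using ab by argo
qed

end

section \<open>Stretching the curve\<close>

lemma inverse_curves_stretch:
  assumes "inverse_curves f g L M \<alpha> \<beta>" and cd: "0 < c" "0 < d"
  shows "inverse_curves (\<lambda>x. d * f (c * x)) (\<lambda>y. 1 / c * g (1 / d * y)) (L / c) (d * M) (\<alpha> / c) (d * \<beta>)"
proof -
  interpret inverse_curves f g L M \<alpha> \<beta> by fact
  have mem: "c * x \<in> {0..L}" if "x \<in> {0..L / c}" for x
    using that cd by (auto simp: field_simps)
  show ?thesis
  proof
    show "strict_antimono_on {0..L / c} (\<lambda>x. d * f (c * x))"
      using cd monotone_onD[OF anti mem mem] by (intro monotone_onI) auto
    show "1 / c * g (1 / d * y) \<in> {0..L / c} \<and> d * f (c * (1 / c * g (1 / d * y))) = y"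
      if "y \<in> {0..d * M}" for y
    proof -
      have "1 / d * y \<in> {0..M}" using that cd by (auto simp: field_simps)
      from g_inv[OF this] cd show ?thesis by (auto simp: divide_right_mono)
    qed
    show "1 / c * g (1 / d * (d * f (c * x))) = x" if "x \<in> {0..L / c}" for x
      using f_inv[OF mem[OF that]] cd by simp
  qed (use \<alpha> \<beta> f_0 f_L f_\<alpha> cd in \<open>auto simp: divide_right_mono\<close>)
qed

lemma C2_on_stretch:
  assumes C2: "C2_on {0..a} f f' f''" and c: "0 < c"
  shows "C2_on {0..a / c} (\<lambda>x. d * f (c * x)) (\<lambda>x. d * c * f' (c * x)) (\<lambda>x. d * c\<^sup>2 * f'' (c * x))"
proof -
  have img: "(\<lambda>x. c * x) ` {0..a / c} \<subseteq> {0..a}" using c by (auto simp: field_simps)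
  have mem: "c * x \<in> {0..a}" if "x \<in> {0..a / c}" for x using img that by blast
  have comp: "((\<lambda>x. e * h (c * x)) has_real_derivative e * c * h' (c * x)) (at x within {0..a / c})"
    if h: "\<forall>t\<in>{0..a}. (h has_real_derivative h' t) (at t within {0..a})" and x: "x \<in> {0..a / c}"
    for h h' e x
  proof -
    have "(h has_real_derivative h' (c * x)) (at (c * x) within (\<lambda>x. c * x) ` {0..a / c})"
      using h mem[OF x] img by (blast intro: has_field_derivative_subset)
    moreover have "((\<lambda>x. c * x) has_real_derivative c) (at x within {0..a / c})"
      by (auto intro!: derivative_eq_intros)
    ultimately have "(h \<circ> (\<lambda>x. c * x) has_real_derivative h' (c * x) * c) (at x within {0..a / c})"
      by (rule DERIV_image_chain)
    from DERIV_cmult[OF this, of e] show ?thesis by (simp add: o_def mult_ac)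
  qed
  have "continuous_on {0..a / c} (\<lambda>x. d * c\<^sup>2 * f'' (c * x))"
    using C2 unfolding C2_on_def
    by (intro continuous_on_mult_left continuous_on_compose2[OF _ _ img] continuous_intros) auto
  then show ?thesis
    using C2 comp[of f f' _ d] comp[of f' f'' _ "d * c"] unfolding C2_on_def
    by (simp add: power2_eq_square mult.assoc)
qed

lemma mono_on_stretch:
  fixes h :: "real \<Rightarrow> real"
  assumes "mono_on {0..a} h \<or> antimono_on {0..a} h" and "0 < c" "0 \<le> e"
  shows "mono_on {0..a / c} (\<lambda>x. e * h (c * x)) \<or> antimono_on {0..a / c} (\<lambda>x. e * h (c * x))"
proof -
  have mem: "c * x \<in> {0..a}" if "x \<in> {0..a / c}" for x
    using that assms(2) by (auto simp: field_simps)
  show ?thesis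
    using assms(1)
  proof
    assume "mono_on {0..a} h"
    from monotone_onD[OF this mem mem] have "mono_on {0..a / c} (\<lambda>x. e * h (c * x))"
      using assms(2,3) by (intro monotone_onI mult_left_mono) auto
    then show ?thesis ..
  next
    assume "antimono_on {0..a} h"
    from monotone_onD[OF this mem mem] have "antimono_on {0..a / c} (\<lambda>x. e * h (c * x))"
      using assms(2,3) by (intro monotone_onI mult_left_mono) auto
    then show ?thesis ..
  qed
qed

lemma image_stretch: "0 < (c::real) \<Longrightarrow> (\<lambda>x. x / c) ` {0..a} = {0..a / c}"
  by (subst image_divide_atLeastAtMost) auto

lemma integral_stretch:
  fixes h :: "real \<Rightarrow> real"
  assumes "continuous_on {0..a} h" and c: "0 < c"
  shows "integral {0..a / c} (\<lambda>x. h (c * x)) = integral {0..a} h / c"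
proof -
  have "(h has_integral integral {0..a} h) {0..a}"
    using assms(1) by (intro integrable_integral integrable_continuous_real)
  from has_integral_stretch_real[OF this, of c] show ?thesis
    using c by (intro integral_unique) (simp add: image_stretch)
qed

lemma SUP_stretch:
  fixes h :: "real \<Rightarrow> real"
  assumes c: "0 < c"
  shows "(SUP x\<in>{0..a / c}. h (c * x)) = (SUP x\<in>{0..a}. h x)"
  unfolding image_stretch[OF c, symmetric] image_image using c by simp

lemma cube_root_curvature_integral_stretch:
  assumes C2: "C2_on {0..a} f f' f''" "\<forall>x\<in>{0..a}. f'' x < 0" and c: "0 < c" and e: "0 < e"
  shows "integral {0..a / c} (\<lambda>x. \<bar>e * f'' (c * x)\<bar> powr (1/3))
    = e powr (1/3) / c * integral {0..a} (\<lambda>x. \<bar>f'' x\<bar> powr (1/3))"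
proof -
  have "continuous_on {0..a} (\<lambda>x. \<bar>f'' x\<bar> powr (1/3))"
    using C2(2) by (intro continuous_on_cube_root_curvature[OF C2(1)]) auto
  then have "integral {0..a / c} (\<lambda>x. e powr (1/3) * \<bar>f'' (c * x)\<bar> powr (1/3))
    = integral {0..a} (\<lambda>x. e powr (1/3) * \<bar>f'' x\<bar> powr (1/3)) / c"
    by (intro integral_stretch[where h = "\<lambda>x. e powr (1/3) * \<bar>f'' x\<bar> powr (1/3)"] c continuous_on_mult_left)
  then show ?thesis using e by (simp add: abs_mult powr_mult)
qed

lemma lattice_count_stretch:
  assumes "0 < r" "0 < s"
  shows "lattice_count (L / (s / r)) (\<lambda>x. r * s * f (s / r * x)) 1 1 = lattice_count L f r s"
proof -
  have "real j * 1 / 1 \<le> L / (s / r) \<longleftrightarrow> real j * s / r \<le> L" for j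
    using assms by (simp add: field_simps)
  moreover have "1 * 1 * (r * s * f (s / r * (real j * 1 / 1))) = r * s * f (real j * s / r)" for j
    by (simp add: mult.commute)
  ultimately show ?thesis unfolding lattice_count_def by (simp only:)
qed

lemma SUP_mult_left_le:
  fixes h :: "'a \<Rightarrow> real"
  assumes "A \<noteq> {}" "bdd_above (h ` A)" "0 \<le> k"
  shows "(SUP x\<in>A. k * h x) \<le> k * (SUP x\<in>A. h x)"
  using assms by (intro cSUP_least mult_left_mono cSUP_upper) auto

text \<open>
  The factor \<open>1 / e\<^sup>1\<^sup>/\<^sup>2\<close> moves out of the supremum. It is written as \<open>k t\<close> so that the part \<open>t\<close>, a power
  of the stretching factor, can remain inside.
\<close>

lemma SUP_radius_stretch_le:
  assumes C2: "C2_on {0..a} f f' f''" "\<forall>x\<in>{0..a}. f'' x < 0" and a: "0 < a" and c: "0 < c"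
    and k: "0 \<le> k" and "0 < e" and e: "1 / e powr (1/2) = k * t"
  shows "(SUP x\<in>{0..a / c}. 1 / \<bar>e * f'' (c * x)\<bar> powr (1/2))
    \<le> k * (SUP x\<in>{0..a}. t / \<bar>f'' x\<bar> powr (1/2))"
proof -
  have "(SUP x\<in>{0..a / c}. 1 / \<bar>e * f'' (c * x)\<bar> powr (1/2))
      = (SUP x\<in>{0..a}. 1 / \<bar>e * f'' x\<bar> powr (1/2))"
    by (rule SUP_stretch[OF c, where h = "\<lambda>x. 1 / \<bar>e * f'' x\<bar> powr (1/2)"])
  also have "\<dots> = (SUP x\<in>{0..a}. k * (t / \<bar>f'' x\<bar> powr (1/2)))"
  proof (intro SUP_cong refl)
    fix x
    have "1 / \<bar>e * f'' x\<bar> powr (1/2) = 1 / e powr (1/2) / \<bar>f'' x\<bar> powr (1/2)"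
      using \<open>0 < e\<close> by (simp add: abs_mult powr_mult)
    then show "1 / \<bar>e * f'' x\<bar> powr (1/2) = k * (t / \<bar>f'' x\<bar> powr (1/2))" by (simp only: e times_divide_eq_right)
  qed
  also have "\<dots> \<le> k * (SUP x\<in>{0..a}. t / \<bar>f'' x\<bar> powr (1/2))"
  proof (rule SUP_mult_left_le[OF _ _ k])
    have "continuous_on {0..a} f''" using C2(1) by (simp add: C2_on_def)
    moreover have "\<bar>f'' x\<bar> \<noteq> 0" "\<bar>f'' x\<bar> powr (1/2) \<noteq> 0" if "x \<in> {0..a}" for x using C2(2) that by force+
    ultimately have "continuous_on {0..a} (\<lambda>x. t / \<bar>f'' x\<bar> powr (1/2))"
      by (intro continuous_on_divide continuous_on_const continuous_on_powr' continuous_on_rabs) auto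
    then have "compact ((\<lambda>x. t / \<bar>f'' x\<bar> powr (1/2)) ` {0..a})"
      by (intro compact_continuous_image) auto
    then show "bdd_above ((\<lambda>x. t / \<bar>f'' x\<bar> powr (1/2)) ` {0..a})"
      by (intro bounded_imp_bdd_above compact_imp_bounded)
  qed (use a in auto)
  finally show ?thesis .
qed

text \<open>
  The stretched curve is the graph of \<open>d f(c x)\<close> with \<open>c = s / r\<close> and \<open>d = r s\<close>, and its inverse is
  \<open>(1 / c) g(y / d)\<close>. The second derivatives are multiplied by \<open>d c\<^sup>2 = s\<^sup>3 / r\<close> and by
  \<open>1 / (c d\<^sup>2) = 1 / (r s\<^sup>3)\<close>. Cube roots of these, with the change of variables, give \<open>r\<^sup>2\<^sup>/\<^sup>3\<close> on both sides;
  the first derivatives are multiplied by \<open>s\<^sup>2\<close> and \<open>1 / s\<^sup>2\<close>.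
\<close>

lemma (in inverse_curves) stretched_lattice_count_asymptotics:
  assumes f: "C2_on {0..\<alpha>} f f' f''"
    and f'_neg: "\<forall>x\<in>{0<..\<alpha>}. f' x < 0" and f''_neg: "\<forall>x\<in>{0..\<alpha>}. f'' x < 0"
    and f_mono: "mono_on {0..\<alpha>} f'' \<or> antimono_on {0..\<alpha>} f''"
    and g: "C2_on {0..\<beta>} g g' g''"
    and g'_neg: "\<forall>y\<in>{0<..\<beta>}. g' y < 0" and g''_neg: "\<forall>y\<in>{0..\<beta>}. g'' y < 0"
    and g_mono: "mono_on {0..\<beta>} g'' \<or> antimono_on {0..\<beta>} g''"
    and r: "0 < r" and s: "0 < s"
  shows "\<bar>real (lattice_count L f r s) - r\<^sup>2 * curve_area L f + r * (L / s + s * M) / 2\<bar>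
      \<le> 6 * r powr (2/3) * (integral {0..\<alpha>} (\<lambda>x. \<bar>f'' x\<bar> powr (1/3))
              + integral {0..\<beta>} (\<lambda>y. \<bar>g'' y\<bar> powr (1/3)))
        + 175 * r powr (1/2) * ((SUP x\<in>{0..\<alpha>}. s powr (-3/2) / \<bar>f'' x\<bar> powr (1/2))
              + (SUP y\<in>{0..\<beta>}. s powr (3/2) / \<bar>g'' y\<bar> powr (1/2)))
        + 1 / 4 * (s\<^sup>2 * \<bar>f' \<alpha>\<bar> + \<bar>g' \<beta>\<bar> / s\<^sup>2) + 3"
proof -
  define c d where "c = s / r" and "d = r * s"
  have cd: "0 < c" "0 < d" "0 < 1 / c" "0 < 1 / d" using r s by (auto simp: c_def d_def)
  interpret S: inverse_curves "\<lambda>x. d * f (c * x)" "\<lambda>y. 1 / c * g (1 / d * y)" "L / c" "d * M" "\<alpha> / c" "d * \<beta>"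
    by (rule inverse_curves_stretch[OF inverse_curves_axioms cd(1,2)])
  have \<beta>_div: "\<beta> / (1 / d) = d * \<beta>" by simp
  note F = C2_on_stretch[OF f cd(1), of d]
  note G = C2_on_stretch[OF g cd(4), of "1 / c", unfolded \<beta>_div]
  let ?e = "d * c\<^sup>2" and ?k = "1 / c * (1 / d)\<^sup>2"
  have e: "0 < ?e" "0 < ?k" using cd by auto
  \<comment> \<open>powers of \<open>r\<close> and \<open>s\<close> are compared through their logarithms\<close>
  have c_exp: "c = exp (ln s - ln r)" and d_exp: "d = exp (ln r + ln s)"
    using r s by (simp_all add: c_def d_def exp_diff exp_add)
  have e_exp: "?e = exp (3 * ln s - ln r)" and k_exp: "?k = exp (- ln r - 3 * ln s)"
    unfolding c_exp d_exp power2_eq_square exp_minus[symmetric] exp_add[symmetric] inverse_eq_divide[symmetric]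
    by (simp_all add: algebra_simps)
  have powr_exp: "r powr t = exp (ln r * t)" "s powr t = exp (ln s * t)" for t
    using r s by (simp_all add: powr_def mult.commute)
  have cont_f: "continuous_on {0..\<alpha>} f" and cont_g: "continuous_on {0..\<beta>} g"
    using f g unfolding C2_on_def
    by (auto intro: DERIV_continuous_on[of _ f f'] DERIV_continuous_on[of _ g g'])
  have "\<bar>real (lattice_count (L / c) (\<lambda>x. d * f (c * x)) 1 1) - curve_area (L / c) (\<lambda>x. d * f (c * x)) + (L / c + d * M) / 2\<bar>
      \<le> 6 * (integral {0..\<alpha> / c} (\<lambda>x. \<bar>?e * f'' (c * x)\<bar> powr (1/3))
              + integral {0..d * \<beta>} (\<lambda>y. \<bar>?k * g'' (1 / d * y)\<bar> powr (1/3)))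
        + 175 * ((SUP x\<in>{0..\<alpha> / c}. 1 / \<bar>?e * f'' (c * x)\<bar> powr (1/2))
              + (SUP y\<in>{0..d * \<beta>}. 1 / \<bar>?k * g'' (1 / d * y)\<bar> powr (1/2)))
        + 1 / 4 * (\<bar>d * c * f' (c * (\<alpha> / c))\<bar> + \<bar>1 / c * (1 / d) * g' (1 / d * (d * \<beta>))\<bar>) + 3"
  proof (rule S.lattice_count_asymptotics[OF F _ _ _ G])
    show "mono_on {0..\<alpha> / c} (\<lambda>x. ?e * f'' (c * x)) \<or> antimono_on {0..\<alpha> / c} (\<lambda>x. ?e * f'' (c * x))"
      using e by (intro mono_on_stretch f_mono cd) auto
    show "mono_on {0..d * \<beta>} (\<lambda>x. ?k * g'' (1 / d * x)) \<or> antimono_on {0..d * \<beta>} (\<lambda>x. ?k * g'' (1 / d * x))"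
      unfolding \<beta>_div[symmetric] using e by (intro mono_on_stretch g_mono cd) auto
    have x: "c * x \<in> {0..\<alpha>}" "0 < x \<Longrightarrow> c * x \<in> {0<..\<alpha>}" if "x \<in> {0..\<alpha> / c}" for x
      using that cd by (auto simp: field_simps)
    have y: "1 / d * y \<in> {0..\<beta>}" "0 < y \<Longrightarrow> 1 / d * y \<in> {0<..\<beta>}" if "y \<in> {0..d * \<beta>}" for y
      using that cd by (auto simp: field_simps)
    show "\<forall>x\<in>{0<..\<alpha> / c}. d * c * f' (c * x) < 0"
      using x f'_neg cd by (intro ballI mult_pos_neg) auto
    show "\<forall>x\<in>{0..\<alpha> / c}. ?e * f'' (c * x) < 0"
      using x f''_neg e by (intro ballI mult_pos_neg) auto
    show "\<forall>y\<in>{0<..d * \<beta>}. 1 / c * (1 / d) * g' (1 / d * y) < 0"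
      using y g'_neg cd by (intro ballI mult_pos_neg) auto
    show "\<forall>y\<in>{0..d * \<beta>}. ?k * g'' (1 / d * y) < 0"
      using y g''_neg e by (intro ballI mult_pos_neg) auto
  qed
  moreover have "lattice_count (L / c) (\<lambda>x. d * f (c * x)) 1 1 = lattice_count L f r s"
    unfolding c_def d_def by (rule lattice_count_stretch[OF r s])
  moreover have "curve_area (L / c) (\<lambda>x. d * f (c * x)) = r\<^sup>2 * curve_area L f"
  proof -
    have "curve_area (L / c) (\<lambda>x. d * f (c * x)) = integral {0..\<alpha> / c} (\<lambda>x. d * f (c * x))
        + integral {0..d * \<beta>} (\<lambda>y. 1 / c * g (1 / d * y)) - \<alpha> / c * (d * \<beta>)"
      using F G unfolding C2_on_def by (intro S.curve_area_eq DERIV_continuous_on) auto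
    also have "integral {0..\<alpha> / c} (\<lambda>x. d * f (c * x)) = d / c * integral {0..\<alpha>} f"
      using integral_stretch[OF cont_f cd(1)] by simp
    also have "integral {0..d * \<beta>} (\<lambda>y. 1 / c * g (1 / d * y)) = d / c * integral {0..\<beta>} g"
      using integral_stretch[OF cont_g cd(4)] unfolding \<beta>_div by simp
    also have "d / c * integral {0..\<alpha>} f + d / c * integral {0..\<beta>} g - \<alpha> / c * (d * \<beta>)
        = d / c * curve_area L f"
      unfolding curve_area_eq[OF cont_f cont_g] by (simp add: algebra_simps)
    also have "d / c = r\<^sup>2" using r s by (simp add: c_def d_def power2_eq_square)
    finally show ?thesis .
  qed
  moreover have "(L / c + d * M) / 2 = r * (L / s + s * M) / 2"
    by (simp add: c_def d_def algebra_simps)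
  moreover have "integral {0..\<alpha> / c} (\<lambda>x. \<bar>?e * f'' (c * x)\<bar> powr (1/3))
      = r powr (2/3) * integral {0..\<alpha>} (\<lambda>x. \<bar>f'' x\<bar> powr (1/3))"
  proof -
    have "?e powr (1/3) / c = r powr (2/3)"
      unfolding e_exp unfolding c_exp exp_powr_real powr_exp exp_diff[symmetric] by (simp add: field_simps)
    then show ?thesis using cube_root_curvature_integral_stretch[OF f f''_neg cd(1) e(1)] by simp
  qed
  moreover have "integral {0..d * \<beta>} (\<lambda>y. \<bar>?k * g'' (1 / d * y)\<bar> powr (1/3))
      = r powr (2/3) * integral {0..\<beta>} (\<lambda>y. \<bar>g'' y\<bar> powr (1/3))"
  proof -
    have "?k powr (1/3) * d = r powr (2/3)"
      unfolding k_exp unfolding d_exp exp_powr_real powr_exp exp_add[symmetric] by (simp add: field_simps)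
    then show ?thesis
      using cube_root_curvature_integral_stretch[OF g g''_neg cd(4) e(2)] unfolding \<beta>_div by simp
  qed
  moreover have "(SUP x\<in>{0..\<alpha> / c}. 1 / \<bar>?e * f'' (c * x)\<bar> powr (1/2))
      \<le> r powr (1/2) * (SUP x\<in>{0..\<alpha>}. s powr (-3/2) / \<bar>f'' x\<bar> powr (1/2))"
  proof (rule SUP_radius_stretch_le[OF f f''_neg \<alpha>(1) cd(1)])
    show "1 / ?e powr (1/2) = r powr (1/2) * s powr (-3/2)"
      unfolding e_exp unfolding exp_powr_real powr_exp exp_add[symmetric] inverse_eq_divide[symmetric] exp_minus[symmetric]
      by (simp add: field_simps)
  qed (use e in simp_all)
  moreover have "(SUP y\<in>{0..d * \<beta>}. 1 / \<bar>?k * g'' (1 / d * y)\<bar> powr (1/2))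
      \<le> r powr (1/2) * (SUP y\<in>{0..\<beta>}. s powr (3/2) / \<bar>g'' y\<bar> powr (1/2))"
    unfolding \<beta>_div[symmetric]
  proof (rule SUP_radius_stretch_le[OF g g''_neg \<beta> cd(4)])
    show "1 / ?k powr (1/2) = r powr (1/2) * s powr (3/2)"
      unfolding k_exp unfolding exp_powr_real powr_exp exp_add[symmetric] inverse_eq_divide[symmetric] exp_minus[symmetric]
      by (simp add: field_simps)
  qed (use e in simp_all)
  moreover have "\<bar>d * c * f' (c * (\<alpha> / c))\<bar> = s\<^sup>2 * \<bar>f' \<alpha>\<bar>"
    using r s by (simp add: c_def d_def abs_mult power2_eq_square)
  moreover have "\<bar>1 / c * (1 / d) * g' (1 / d * (d * \<beta>))\<bar> = \<bar>g' \<beta>\<bar> / s\<^sup>2"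
    using r s by (simp add: c_def d_def abs_mult power2_eq_square)
  ultimately show ?thesis
    unfolding distrib_left mult.assoc by linarith
qed

theorem proposition11:
  fixes f g f' f'' g' g'' :: "real \<Rightarrow> real" and L M \<alpha> \<beta> :: real
  assumes "0 < L" and "0 < M"
    and "continuous_on {0..L} f" and "concave_on {0..L} f" and "strict_antimono_on {0..L} f"
    and "f 0 = M" and "f L = 0"
    and "\<forall>y\<in>{0..M}. g y \<in> {0..L} \<and> f (g y) = y"
    and "\<forall>x\<in>{0..L}. g (f x) = x"
    and "(\<alpha>, \<beta>) \<in> curve L f" and "0 < \<alpha>" and "0 < \<beta>"
    and "C2_on {0..\<alpha>} f f' f''"
    and "\<forall>x\<in>{0<..\<alpha>}. f' x < 0" and "\<forall>x\<in>{0..\<alpha>}. f'' x < 0"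
    and "C2_on {0..\<beta>} g g' g''"
    and "\<forall>y\<in>{0<..\<beta>}. g' y < 0" and "\<forall>y\<in>{0..\<beta>}. g'' y < 0"
    and "mono_on {0..\<alpha>} f'' \<or> antimono_on {0..\<alpha>} f''"
    and "mono_on {0..\<beta>} g'' \<or> antimono_on {0..\<beta>} g''"
  shows "\<bar>real (lattice_count L f 1 1) - curve_area L f + (L + M) / 2\<bar>
      \<le> 6 * (integral {0..\<alpha>} (\<lambda>x. \<bar>f'' x\<bar> powr (1/3))
              + integral {0..\<beta>} (\<lambda>y. \<bar>g'' y\<bar> powr (1/3)))
        + 175 * ((SUP x\<in>{0..\<alpha>}. 1 / \<bar>f'' x\<bar> powr (1/2))
              + (SUP y\<in>{0..\<beta>}. 1 / \<bar>g'' y\<bar> powr (1/2)))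
        + 1 / 4 * (\<bar>f' \<alpha>\<bar> + \<bar>g' \<beta>\<bar>) + 3
    \<and> (\<forall>r>0. \<forall>s>0.
      \<bar>real (lattice_count L f r s) - r\<^sup>2 * curve_area L f
          + r * (L / s + s * M) / 2\<bar>
      \<le> 6 * r powr (2/3) * (integral {0..\<alpha>} (\<lambda>x. \<bar>f'' x\<bar> powr (1/3))
              + integral {0..\<beta>} (\<lambda>y. \<bar>g'' y\<bar> powr (1/3)))
        + 175 * r powr (1/2) * ((SUP x\<in>{0..\<alpha>}. s powr (-3/2) / \<bar>f'' x\<bar> powr (1/2))
              + (SUP y\<in>{0..\<beta>}. s powr (3/2) / \<bar>g'' y\<bar> powr (1/2)))
        + 1 / 4 * (s\<^sup>2 * \<bar>f' \<alpha>\<bar> + \<bar>g' \<beta>\<bar> / s\<^sup>2) + 3)"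
proof -
  have \<alpha>\<beta>: "\<alpha> \<le> L" "f \<alpha> = \<beta>" using assms(10) by (auto simp: curve_def)
  interpret inverse_curves f g L M \<alpha> \<beta>
    by standard (use assms(5-9,11,12) \<alpha>\<beta> in auto)
  note stretched = stretched_lattice_count_asymptotics[OF assms(13-15,19,16-18,20)]
  show ?thesis using stretched[of 1 1] stretched by simp
qed

end
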